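(* Let $\{U_i^N\}_{1\le i\le N,\,N\in\mathbb{N}}$ be i.i.d. exponential random variables of rate $1$, let $$(X_1^N,\dots,X_N^N)=\left(\frac{NU_1^N}{\sum_{i=1}^NU_i^N},\dots,\frac{NU_N^N}{\sum_{i=1}^NU_i^N}\right),$$ and define the empirical measure $\mu_0^N=\frac1N\sum_{i=1}^N\delta_{X_i^N}$. Then, as $N\to\infty$, $$\mu_0^N\Longrightarrow\mu_0\sim\mathrm{Exp}(1),\qquad\mathbb{P}\text{-a.s.}$$ As such, for all $t>0$ the mean-field limit $\mu_t$ satisfies $\mu_t\sim\mathrm{Exp}(1)$.
   Context: $\mathrm{Exp}(1)$ is the exponential distribution with mean $1$; $\mathbb{P}$ is the law of the array; $\Rightarrow$ denotes weak convergence of probability measures on $\mathbb{R}_+=[0,\infty)$. Mean-field limit: for each $N\ge 2$ start from the wealth vector $(X_1^N,\dots,X_N^N)$, whose total wealth is $N$, the continuous-time Markov jump process $(X_t^{1,N},\dots,X_t^{N,N})$ in which each ordered pair $(i,j)$, $i\ne j$, interacts at rate $1/N$. At an interaction, a fresh independent $r$ uniform on $[0,1]$ is drawn and $(X^{i,N},X^{j,N})$ is replaced by $(r(X^{i,N}+X^{j,N}),(1-r)(X^{i,N}+X^{j,N}))$. Let $\mu_t^N=\frac1N\sum_i\delta_{X_t^{i,N}}$. The mean-field limit $(\mu_t)_{t\ge0}$ is the limit in probability of $(\mu_t^N)_{t\ge0}$ as $N\to\infty$ in the Skorokhod space $D([0,\infty);\mathcal{M}_1(\mathbb{R}_+))$,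 with $\mathcal{M}_1(\mathbb{R}_+)$ the probability measures on $\mathbb{R}_+$ with the weak topology. It solves the kinetic equation, for all bounded continuous $g$ on $\mathbb{R}_+$, $$\int g\,d\mu_t=\int g\,d\mu_0+\int_0^t\int_0^1\int_{\mathbb{R}_+^2}\big(g(r(x+y))+g((1-r)(x+y))-g(x)-g(y)\big)\mu_s(dx)\mu_s(dy)\,dr\,ds.$$ *)

theory Defs
  imports "HOL-Probability.Probability"
begin

section \<open>Wealth vectors and their empirical measure\<close>

text \<open>A wealth vector of \<open>N\<close> agents is a function \<open>nat \<Rightarrow> real\<close>, of which only the values at
  \<open>1, \<dots>, N\<close> matter.\<close>

definition normalized_wealth :: "nat \<Rightarrow> (nat \<Rightarrow> real) \<Rightarrow> nat \<Rightarrow> real" where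
  "normalized_wealth N u i = real N * u i / (\<Sum>j\<in>{1..N}. u j)"

text \<open>The law of \<open>x i\<close> for an index \<open>i\<close> uniform in \<open>{1..N}\<close>; the lemma below shows that it is
  \<open>1/N\<close> times the sum of the point masses at the \<open>x i\<close>.\<close>

definition empirical_measure :: "nat \<Rightarrow> (nat \<Rightarrow> real) \<Rightarrow> real measure" where
  "empirical_measure N x = distr (uniform_count_measure {1..N}) borel x"

lemma measure_empirical_measure:
  assumes "A \<in> sets borel"
  shows "measure (empirical_measure N x) A = (\<Sum>i\<in>{1..N}. measure (return borel (x i)) A) / real N"
proof -
  have "x -` A \<inter> {1..N} = {i \<in> {1..N}. x i \<in> A}"
    by auto
  moreover have "x \<in> uniform_count_measure {1..N} \<rightarrow>\<^sub>M borel"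
    by (auto simp: measurable_def space_uniform_count_measure sets_uniform_count_measure)
  moreover have "measure (uniform_count_measure {1..N}) {i \<in> {1..N}. x i \<in> A} =
      real (card {i \<in> {1..N}. x i \<in> A}) / real (card {1..N})"
    by (rule measure_uniform_count_measure) auto
  ultimately have "measure (empirical_measure N x) A = real (card {i \<in> {1..N}. x i \<in> A}) / real N"
    using assms
    by (simp only: empirical_measure_def measure_distr space_uniform_count_measure card_atLeastAtMost)
       simp
  also have "real (card {i \<in> {1..N}. x i \<in> A}) = (\<Sum>i\<in>{1..N}. indicator A (x i))"
    by (simp add: indicator_def sum.If_cases Int_def)
  finally show ?thesis
    using assms by (simp add: measure_return)
qed


section \<open>The interacting particle system\<close>

text \<open>Every ordered pair \<open>(i, j)\<close> carries a Poisson clock, given by its interarrival times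
  \<open>g i j 0, g i j 1, \<dots>\<close>, and \<open>r i j k\<close> is the splitting variable used when this clock rings for
  the \<open>k\<close>-th time, counting from 0.\<close>

definition exchange :: "nat \<Rightarrow> nat \<Rightarrow> real \<Rightarrow> (nat \<Rightarrow> real) \<Rightarrow> nat \<Rightarrow> real" where
  "exchange i j r x = x(i := r * (x i + x j), j := (1 - r) * (x i + x j))"

definition ring_time :: "(nat \<Rightarrow> nat \<Rightarrow> nat \<Rightarrow> real) \<Rightarrow> nat \<times> nat \<times> nat \<Rightarrow> real" where
  "ring_time g = (\<lambda>(i, j, k). \<Sum>l\<le>k. g i j l)"

definition rings_until :: "nat \<Rightarrow> (nat \<Rightarrow> nat \<Rightarrow> nat \<Rightarrow> real) \<Rightarrow> real \<Rightarrow> (nat \<times> nat \<times> nat) set" where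
  "rings_until N g t =
     {(i, j, k). i \<in> {1..N} \<and> j \<in> {1..N} \<and> i \<noteq> j \<and> ring_time g (i, j, k) \<le> t}"

text \<open>The state at time \<open>t\<close>: the interactions up to time \<open>t\<close> are applied in chronological order.
  For the clocks of \<open>exchange_dynamics\<close> below, almost surely only finitely many of them
  have rung by time \<open>t\<close>, and no two ring simultaneously. On the remaining null event the value of
  \<open>sorted_key_list_of_set\<close>, hence of the state, is irrelevant.\<close>

definition wealth_at ::
  "nat \<Rightarrow> (nat \<Rightarrow> nat \<Rightarrow> nat \<Rightarrow> real) \<Rightarrow> (nat \<Rightarrow> nat \<Rightarrow> nat \<Rightarrow> real) \<Rightarrow> (nat \<Rightarrow> real) \<Rightarrow> real \<Rightarrow> nat \<Rightarrow> real"
  where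
  "wealth_at N g r x t =
     fold (\<lambda>(i, j, k). exchange i j (r i j k))
       (sorted_key_list_of_set (ring_time g) (rings_until N g t)) x"

datatype noise_source = Initial nat | Gap nat nat nat | Split nat nat nat

definition noise_sources :: "nat \<Rightarrow> noise_source set" where
  "noise_sources N =
     {Initial i | i. i \<in> {1..N}} \<union>
     {Gap i j k | i j k. i \<in> {1..N} \<and> j \<in> {1..N} \<and> i \<noteq> j} \<union>
     {Split i j k | i j k. i \<in> {1..N} \<and> j \<in> {1..N} \<and> i \<noteq> j}"

text \<open>Independent Poisson clocks of rate \<open>1/N\<close> for all ordered pairs and fresh uniform splitting
  variables, independent of each other and of the variables \<open>u\<close> which determine the initial state.\<close>

definition exchange_dynamics ::
  "'a measure \<Rightarrow> nat \<Rightarrow> (nat \<Rightarrow> 'a \<Rightarrow> real) \<Rightarrow> (nat \<Rightarrow> nat \<Rightarrow> nat \<Rightarrow> 'a \<Rightarrow> real) \<Rightarrow>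
    (nat \<Rightarrow> nat \<Rightarrow> nat \<Rightarrow> 'a \<Rightarrow> real) \<Rightarrow> bool" where
  "exchange_dynamics M N u g r \<longleftrightarrow>
     prob_space.indep_vars M (\<lambda>_. borel)
       (\<lambda>s. case s of Initial i \<Rightarrow> u i | Gap i j k \<Rightarrow> g i j k | Split i j k \<Rightarrow> r i j k)
       (noise_sources N) \<and>
     (\<forall>i\<in>{1..N}. \<forall>j\<in>{1..N}. \<forall>k. i \<noteq> j \<longrightarrow>
        distributed M lborel (g i j k) (exponential_density (1 / real N)) \<and>
        distr M borel (r i j k) = uniform_measure lborel {0..1})"


section \<open>The Skorokhod space of paths of probability measures on the half-line\<close>

text \<open>Probability measures on \<open>[0, \<infinity>)\<close> are represented as Borel probability measures on the real
  line concentrated on \<open>[0, \<infinity>)\<close>.\<close>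

definition half_line_distribution :: "real measure \<Rightarrow> bool" where
  "half_line_distribution P \<longleftrightarrow> real_distribution P \<and> emeasure P {0..} = 1"

text \<open>The Prohorov distance metrizes the weak topology.\<close>

definition prohorov_dist :: "real measure \<Rightarrow> real measure \<Rightarrow> real" where
  "prohorov_dist P Q = Inf {\<epsilon>. 0 < \<epsilon> \<and> (\<forall>A\<in>sets borel.
     measure P A \<le> measure Q (\<Union>a\<in>A. ball a \<epsilon>) + \<epsilon> \<and>
     measure Q A \<le> measure P (\<Union>a\<in>A. ball a \<epsilon>) + \<epsilon>)}"

definition cadlag_path :: "(real \<Rightarrow> real measure) \<Rightarrow> bool" where
  "cadlag_path \<mu> \<longleftrightarrow>
     (\<forall>t\<ge>0. half_line_distribution (\<mu> t)) \<and>
     (\<forall>t\<ge>0. ((\<lambda>s. prohorov_dist (\<mu> s) (\<mu> t)) \<longlongrightarrow> 0) (at_right t)) \<and>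
     (\<forall>t>0. \<exists>\<nu>. half_line_distribution \<nu> \<and>
        ((\<lambda>s. prohorov_dist (\<mu> s) \<nu>) \<longlongrightarrow> 0) (at_left t))"

text \<open>The metric of Ethier and Kurtz (Markov Processes, Section 3.5) for the Skorokhod
  \<open>J\<^sub>1\<close> topology on paths over \<open>[0, \<infinity>)\<close>. Time changes of infinite distortion do not contribute to
  the infimum.\<close>

definition time_change :: "(real \<Rightarrow> real) \<Rightarrow> bool" where
  "time_change l \<longleftrightarrow> strict_mono_on {0..} l \<and> bij_betw l {0..} {0..}"

definition distortion :: "(real \<Rightarrow> real) \<Rightarrow> ennreal" where
  "distortion l = (SUP (s, t)\<in>{(s, t). 0 \<le> s \<and> s < t}. ennreal \<bar>ln ((l t - l s) / (t - s))\<bar>)"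

definition skorokhod_dist ::
  "('b \<Rightarrow> 'b \<Rightarrow> real) \<Rightarrow> (real \<Rightarrow> 'b) \<Rightarrow> (real \<Rightarrow> 'b) \<Rightarrow> ennreal" where
  "skorokhod_dist \<rho> x y = (INF l\<in>{l. time_change l}.
     max (distortion l)
       (\<integral>\<^sup>+u\<in>{0..}. ennreal (exp (- u)) *
          (SUP t\<in>{0..}. ennreal (min 1 (\<rho> (x (min t u)) (y (min (l t) u))))) \<partial>lborel))"


section \<open>Mean-field limit\<close>

text \<open>Using the outer probability means that a set which fails to be measurable does not count as
  an event of probability zero.\<close>

definition outer_prob :: "'a measure \<Rightarrow> 'a set \<Rightarrow> ennreal" where
  "outer_prob M A = (INF B\<in>{B \<in> sets M. A \<subseteq> B}. emeasure M B)"

text \<open>\<open>\<mu>\<close> is the limit in probability, in the Skorokhod space, of the empirical measures of the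
  processes \<open>X N\<close>, where \<open>X N \<omega> t\<close> is the wealth vector of the \<open>N\<close> agents at time \<open>t\<close>.\<close>

definition mean_field_limit ::
  "'a measure \<Rightarrow> (nat \<Rightarrow> 'a \<Rightarrow> real \<Rightarrow> nat \<Rightarrow> real) \<Rightarrow> (real \<Rightarrow> real measure) \<Rightarrow> bool" where
  "mean_field_limit M X \<mu> \<longleftrightarrow> cadlag_path \<mu> \<and>
     (\<forall>\<epsilon>>0. (\<lambda>N. outer_prob M {\<omega> \<in> space M.
        skorokhod_dist prohorov_dist (\<lambda>t. empirical_measure N (X N \<omega> t)) \<mu> > ennreal \<epsilon>})
        \<longlonglongrightarrow> 0)"

end

theory Submission
  imports Defs
begin

text \<open>
  The law of independent standard exponential variables is invariant under an exchange: if \<open>x\<close>, \<open>y\<close> are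
  independent and exponential and \<open>r\<close> is uniform on \<open>[0, 1]\<close> and independent of them, then
  \<open>r * (x + y)\<close> and \<open>(1 - r) * (x + y)\<close> are again independent and exponential
  (\<open>redistribution_of_exponentials\<close>). Conditionally on the chronological order of the interactions up to
  time \<open>t\<close>, the dynamics is a fixed sequence of exchanges with fresh splitting variables, so it maps
  independent exponential variables to independent exponential variables
  (\<open>replay_iid_exponential\<close>). Exchanges are linear and conserve the total wealth, hence they commute
  with the normalization (\<open>fold_exchange_normalized_wealth\<close>). Consequently the wealth at every time
  \<open>t\<close> has the law of the initial wealth: the normalization of \<open>N\<close> independent exponential variables.

  For such a normalized sample, the empirical distribution function at a point \<open>z\<close> deviates from that of
  the exponential law with a probability that is exponentially small in \<open>N\<close>
  (\<open>normalized_empirical_cdf_concentration\<close>): a Cramer bound controls the sum by which the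
  variables are divided, and Hoeffding's inequality controls the counts. By the Borel-Cantelli lemma,
  applied at all rational points, the empirical measures of the initial wealth converge weakly almost
  surely.

  For the mean-field limit \<open>\<mu>\<close>, convergence in probability for the Skorokhod metric implies only that the
  empirical measure at time \<open>t\<close> is close to \<open>\<mu> s\<close> for some time \<open>s\<close> near \<open>t\<close>
  (\<open>skorokhod_dist_less_imp_close\<close>). Since the empirical measure at time \<open>t\<close> is also close to the exponential
  law, there are times arbitrarily near any given time at which \<open>\<mu>\<close> is arbitrarily close to the exponential
  law. Right-continuity of \<open>\<mu>\<close> then identifies \<open>\<mu> t\<close> for every \<open>t\<close>
  (\<open>cadlag_path_eq_if_close_cdf\<close>).
\<close>

section \<open>Empirical measures of normalized exponential samples\<close>

abbreviation (input) std_exponential :: "real measure" where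
  "std_exponential \<equiv> density lborel (exponential_density 1)"

lemma real_distribution_std_exponential: "real_distribution std_exponential"
  by (simp add: real_distribution_def real_distribution_axioms_def prob_space_exponential_density)

lemma isCont_cdf_std_exponential: "isCont (cdf std_exponential) x"
proof -
  interpret real_distribution std_exponential
    by (rule real_distribution_std_exponential)
  have "emeasure std_exponential {x} = 0"
    by (subst emeasure_density) (auto simp: nn_integral_0_iff_AE emeasure_density intro!: AE_I[of _ _ "{x}"])
  then show ?thesis
    by (simp add: isCont_cdf measure_def)
qed

lemma cdf_empirical_measure:
  "cdf (empirical_measure N x) z = (\<Sum>i\<in>{1..N}. indicator {..z} (x i)) / real N"
  by (simp add: cdf_def measure_empirical_measure measure_return)

lemma real_distribution_empirical_measure:
  assumes "1 \<le> N"
  shows "real_distribution (empirical_measure N x)"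
proof -
  interpret prob_space "uniform_count_measure {1..N}"
    using assms by (intro prob_space_uniform_count_measure) auto
  show ?thesis
    unfolding empirical_measure_def
    by (intro real_distribution_distr)
       (auto simp: measurable_def space_uniform_count_measure sets_uniform_count_measure)
qed

text \<open>The exponential rate in the large deviation bound for the mean is strictly positive.\<close>

lemma mult_exp_one_minus_less_1:
  fixes a :: real
  assumes "0 < a" "a \<noteq> 1"
  shows "a * exp (1 - a) < 1"
proof -
  have "ln a < a - 1"
    using ln_le_minus_one[of a] ln_eq_minus_one[of a] assms by force
  then have "exp (ln a + (1 - a)) < 1"
    by simp
  then show ?thesis
    using assms by (simp add: exp_add)
qed

text \<open>Tilting the standard exponential density by \<open>1 - 1 / a\<close> yields \<open>a\<close> times the exponential density
  with mean \<open>a\<close>.\<close>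

lemma nn_integral_exponential_tilt:
  assumes "0 < a"
  shows "(\<integral>\<^sup>+x. ennreal (exponential_density 1 x) * ennreal (exp ((1 - 1 / a) * x)) \<partial>lborel) = ennreal a"
proof -
  have "(\<integral>\<^sup>+x. ennreal (exponential_density 1 x) * ennreal (exp ((1 - 1 / a) * x)) \<partial>lborel)
      = (\<integral>\<^sup>+x. ennreal a * ennreal (exponential_density (1 / a) x) \<partial>lborel)"
    using assms
    by (intro nn_integral_cong)
       (auto simp: exponential_density_def field_simps simp flip: ennreal_mult exp_add)
  also have "\<dots> = ennreal a * (\<integral>\<^sup>+x. ennreal (exponential_density (1 / a) x) \<partial>lborel)"
    by (intro nn_integral_cmult) auto
  also have "(\<integral>\<^sup>+x. ennreal (exponential_density (1 / a) x) \<partial>lborel) = 1"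
    using nn_integral_erlang_ith_moment[of "1 / a" 0 0] assms by simp
  finally show ?thesis by simp
qed

context prob_space begin

text \<open>Exponential Markov inequality with the parameter \<open>1 - 1 / a\<close>, which is optimal for the level \<open>a\<close>.
  Its sign is that of \<open>a - 1\<close>; keeping it as a factor on both sides of the inequality lets one
  statement cover the upper and the lower tail.\<close>

lemma exponential_sum_Cramer_bound:
  assumes indep: "indep_vars (\<lambda>_. borel) V {1..N}"
    and V: "\<And>i. i \<in> {1..N} \<Longrightarrow> distributed M lborel (V i) (exponential_density 1)"
    and a: "0 < a"
  shows "prob {\<omega> \<in> space M. (1 - 1 / a) * (a * real N) \<le> (1 - 1 / a) * (\<Sum>i\<in>{1..N}. V i \<omega>)}
    \<le> (a * exp (1 - a)) ^ N"
proof -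
  define l where "l = 1 - 1 / a"
  have rv[measurable]: "random_variable borel (V i)" if "i \<in> {1..N}" for i
    using indep that by (auto simp: indep_vars_def)
  have la: "l * a = a - 1"
    using a by (simp add: l_def field_simps)
  define c where "c = exp (- (l * (a * real N)))"
  have "emeasure M {\<omega> \<in> space M. l * (a * real N) \<le> l * (\<Sum>i\<in>{1..N}. V i \<omega>)}
      = emeasure M {\<omega> \<in> space M. 1 \<le> ennreal c * (\<Prod>i\<in>{1..N}. ennreal (exp (l * V i \<omega>)))}"
    by (intro arg_cong[where f = "emeasure M"] Collect_cong)
       (simp add: c_def prod_ennreal flip: ennreal_mult exp_sum exp_add sum_distrib_left ennreal_1)
  also have "\<dots> \<le> ennreal c * (\<integral>\<^sup>+\<omega>. (\<Prod>i\<in>{1..N}. ennreal (exp (l * V i \<omega>))) * indicator (space M) \<omega> \<partial>M)"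
    by (intro nn_integral_Markov_inequality) auto
  also have "(\<integral>\<^sup>+\<omega>. (\<Prod>i\<in>{1..N}. ennreal (exp (l * V i \<omega>))) * indicator (space M) \<omega> \<partial>M)
      = (\<integral>\<^sup>+\<omega>. (\<Prod>i\<in>{1..N}. ennreal (exp (l * V i \<omega>))) \<partial>M)"
    by (intro nn_integral_cong) auto
  also have "\<dots> = (\<Prod>i\<in>{1..N}. \<integral>\<^sup>+\<omega>. ennreal (exp (l * V i \<omega>)) \<partial>M)"
    by (intro indep_vars_nn_integral indep_vars_compose2[OF indep, where Y = "\<lambda>_ x. ennreal (exp (l * x))"])
       auto
  also have "\<dots> = (\<Prod>i\<in>{1..N}. ennreal a)"
  proof (intro prod.cong refl)
    fix i assume "i \<in> {1..N}"
    from distributed_nn_integral[OF V[OF this], of "\<lambda>x. ennreal (exp (l * x))"]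
    show "(\<integral>\<^sup>+\<omega>. ennreal (exp (l * V i \<omega>)) \<partial>M) = ennreal a"
      using nn_integral_exponential_tilt[OF a] by (simp add: l_def)
  qed
  also have "ennreal c * \<dots> = ennreal (c * a ^ N)"
    using a by (simp add: c_def ennreal_mult ennreal_power)
  also have "c = exp (1 - a) ^ N"
  proof -
    have "- (l * (a * real N)) = real N * (1 - a)"
      unfolding mult.assoc[symmetric] la by (simp add: algebra_simps)
    then show ?thesis
      by (simp add: c_def exp_of_nat_mult)
  qed
  also have "exp (1 - a) ^ N * a ^ N = (a * exp (1 - a)) ^ N"
    by (simp add: power_mult_distrib)
  finally show ?thesis
    using a by (simp add: emeasure_eq_measure l_def)
qed

lemma exponential_mean_concentration:
  assumes indep: "indep_vars (\<lambda>_. borel) V {1..N}"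
    and V: "\<And>i. i \<in> {1..N} \<Longrightarrow> distributed M lborel (V i) (exponential_density 1)"
    and d: "0 < d" "d < 1"
  shows "prob {\<omega> \<in> space M. d * real N < \<bar>(\<Sum>i\<in>{1..N}. V i \<omega>) - real N\<bar>}
    \<le> ((1 + d) * exp (- d)) ^ N + ((1 - d) * exp d) ^ N"
proof -
  have rv[measurable]: "random_variable borel (V i)" if "i \<in> {1..N}" for i
    using indep that by (auto simp: indep_vars_def)
  define A where "A a = {\<omega> \<in> space M. (1 - 1 / a) * (a * real N) \<le> (1 - 1 / a) * (\<Sum>i\<in>{1..N}. V i \<omega>)}"
    for a :: real
  have [measurable]: "A a \<in> events" for a
    unfolding A_def by measurable
  have up: "(1 - 1 / (1 + d)) * x \<le> (1 - 1 / (1 + d)) * y \<longleftrightarrow> x \<le> y" for x y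
    using d by (intro mult_le_cancel_left_pos) (simp add: field_simps)
  have lo: "(1 - 1 / (1 - d)) * x \<le> (1 - 1 / (1 - d)) * y \<longleftrightarrow> y \<le> x" for x y
    using d by (intro mult_le_cancel_left_neg) (simp add: field_simps)
  have "{\<omega> \<in> space M. d * real N < \<bar>(\<Sum>i\<in>{1..N}. V i \<omega>) - real N\<bar>} \<subseteq> A (1 + d) \<union> A (1 - d)"
    unfolding A_def up lo by (auto simp: algebra_simps)
  then have "prob {\<omega> \<in> space M. d * real N < \<bar>(\<Sum>i\<in>{1..N}. V i \<omega>) - real N\<bar>} \<le> prob (A (1 + d) \<union> A (1 - d))"
    by (intro finite_measure_mono) auto
  also have "\<dots> \<le> prob (A (1 + d)) + prob (A (1 - d))"
    by (intro measure_Un_le) auto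
  also have "\<dots> \<le> ((1 + d) * exp (- d)) ^ N + ((1 - d) * exp d) ^ N"
    using exponential_sum_Cramer_bound[OF indep V, of "1 + d"]
      exponential_sum_Cramer_bound[OF indep V, of "1 - d"] d
    unfolding A_def by (intro add_mono) auto
  finally show ?thesis .
qed

text \<open>Hoeffding's inequality for the indicators of \<open>{..z}\<close>.\<close>

lemma empirical_count_concentration:
  assumes indep: "indep_vars (\<lambda>_. borel) V {1..N}"
    and V: "\<And>i. i \<in> {1..N} \<Longrightarrow> distributed M lborel (V i) (exponential_density 1)"
    and N: "1 \<le> N" and \<eta>: "0 \<le> \<eta>"
  shows "prob {\<omega> \<in> space M. \<eta> \<le> \<bar>(\<Sum>i\<in>{1..N}. indicator {..z} (V i \<omega>)) / real N - cdf std_exponential z\<bar>}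
    \<le> 2 * exp (- 2 * real N * \<eta>\<^sup>2)"
proof -
  have rv[measurable]: "random_variable borel (V i)" if "i \<in> {1..N}" for i
    using indep that by (auto simp: indep_vars_def)
  have distr: "distr M borel (V i) = std_exponential" if "i \<in> {1..N}" for i
    using distributed_distr_eq_density[OF V[OF that]]
    by (metis distr_cong sets_lborel)
  have rvY: "random_variable borel (\<lambda>\<omega>. indicator {..z} (V 1 \<omega>) :: real)"
    using N by (intro measurable_compose[OF rv]) auto
  have dX: "distr M borel (\<lambda>\<omega>. indicator {..z} (V i \<omega>) :: real)
      = distr std_exponential borel (indicator {..z})" if "i \<in> {1..N}" for i
    using that by (subst distr[OF that, symmetric]) (simp add: distr_distr comp_def)
  have 1: "1 \<in> {1..N}"
    using N by simp
  have "(\<integral>x. indicator {..z} x \<partial>distr M borel (V 1)) = expectation (\<lambda>\<omega>. indicator {..z} (V 1 \<omega>) :: real)"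
    by (rule integral_distr[OF rv[OF 1]]) simp
  then have "expectation (\<lambda>\<omega>. indicator {..z} (V 1 \<omega>) :: real) = (\<integral>x. indicator {..z} x \<partial>std_exponential)"
    by (simp only: distr[OF 1])
  also have "\<dots> = cdf std_exponential z"
    by (simp add: cdf_def)
  finally have \<mu>: "expectation (\<lambda>\<omega>. indicator {..z} (V 1 \<omega>)) = cdf std_exponential z" .
  interpret H: Hoeffding_ineq_iid M "{1..N}" "\<lambda>i \<omega>. indicator {..z} (V i \<omega>)"
      "\<lambda>\<omega>. indicator {..z} (V 1 \<omega>)" 0 1 "cdf std_exponential z"
  proof unfold_locales
    show "indep_vars (\<lambda>_. borel) (\<lambda>i \<omega>. indicator {..z} (V i \<omega>) :: real) {1..N}"
      by (intro indep_vars_compose2[OF indep]) auto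
    show "distr M borel (\<lambda>\<omega>. indicator {..z} (V i \<omega>) :: real) = distr M borel (\<lambda>\<omega>. indicator {..z} (V 1 \<omega>))"
      if "i \<in> {1..N}" for i
      using dX[OF that] dX[of 1] N by simp
  qed (use rvY \<mu> in \<open>auto simp: indicator_def\<close>)
  show ?thesis
    using H.Hoeffding_ineq_abs_ge'[OF \<eta>] N by simp
qed

text \<open>If the sum \<open>S\<close> of the variables lies within \<open>d * N\<close> of \<open>N\<close>, then \<open>N * V i / S \<le> z\<close> is implied by \<open>V i \<le> z - \<bar>z\<bar> * d\<close> and
  implies \<open>V i \<le> z + \<bar>z\<bar> * d\<close>. This squeezes the normalized empirical distribution function between
  the plain one at two points near \<open>z\<close>. The bound is the same for all families with the given law;
  hence it applies to the initial wealth and to the wealth at a later time alike.\<close>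

lemma normalized_empirical_cdf_concentration:
  assumes \<eta>: "0 < \<eta>"
  shows "\<exists>p. summable p \<and> (\<forall>N V. indep_vars (\<lambda>_. borel) V {1..N} \<longrightarrow>
      (\<forall>i\<in>{1..N}. distributed M lborel (V i) (exponential_density 1)) \<longrightarrow>
      prob {\<omega> \<in> space M. \<eta> < \<bar>cdf (empirical_measure N (normalized_wealth N (\<lambda>i. V i \<omega>))) z
        - cdf std_exponential z\<bar>} \<le> p N)"
proof -
  define F where "F = cdf std_exponential"
  obtain e where e: "e > 0" "\<And>y. \<bar>y - z\<bar> < e \<Longrightarrow> \<bar>F y - F z\<bar> < \<eta> / 2"
    using isCont_cdf_std_exponential[of z] \<eta>
    unfolding F_def continuous_at_eps_delta by (metis dist_real_def half_gt_zero real_norm_def)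
  \<comment> \<open>The margin \<open>\<bar>z\<bar> * d\<close> has to stay below \<open>e\<close>; a value below \<open>1\<close> keeps \<open>S\<close> positive.\<close>
  define d where "d = min (1 / 2) (e / (2 * (\<bar>z\<bar> + 1)))"
  have d: "0 < d" "d < 1"
    using e(1) by (auto simp: d_def)
  have "\<bar>z\<bar> * d \<le> \<bar>z\<bar> * (e / (2 * (\<bar>z\<bar> + 1)))"
    by (intro mult_left_mono) (auto simp: d_def)
  also have "\<dots> < e"
    using e(1) by (simp add: field_simps add_strict_increasing2 add_pos_nonneg)
  finally have zd: "\<bar>z\<bar> * d < e" .
  define z1 where "z1 = z - \<bar>z\<bar> * d"
  define z2 where "z2 = z + \<bar>z\<bar> * d"
  have "\<bar>F z1 - F z\<bar> < \<eta> / 2" "\<bar>F z2 - F z\<bar> < \<eta> / 2"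
    using d(1) zd by (intro e(2); simp add: z1_def z2_def abs_mult)+
  then have F1: "F z - \<eta> / 2 < F z1" and F2: "F z2 < F z + \<eta> / 2"
    by linarith+
  define p where "p N = ((1 + d) * exp (- d)) ^ N + ((1 - d) * exp d) ^ N
      + 4 * exp (- 2 * (\<eta> / 2)\<^sup>2) ^ N" for N
  have ratios: "(1 + d) * exp (- d) < 1" "(1 - d) * exp d < 1"
    using mult_exp_one_minus_less_1[of "1 + d"] mult_exp_one_minus_less_1[of "1 - d"] d by auto
  show ?thesis
  proof (intro exI[of _ p] conjI allI impI)
    show "summable p"
      unfolding p_def using d ratios \<eta>
      by (intro summable_add summable_mult summable_geometric) auto
    fix N :: nat and V :: "nat \<Rightarrow> 'a \<Rightarrow> real"
    assume indep: "indep_vars (\<lambda>_. borel) V {1..N}"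
      and "\<forall>i\<in>{1..N}. distributed M lborel (V i) (exponential_density 1)"
    then have V: "\<And>i. i \<in> {1..N} \<Longrightarrow> distributed M lborel (V i) (exponential_density 1)"
      by blast
    have rv[measurable]: "random_variable borel (V i)" if "i \<in> {1..N}" for i
      using indep that by (auto simp: indep_vars_def)
    define S where "S \<omega> = (\<Sum>i\<in>{1..N}. V i \<omega>)" for \<omega>
    define C where "C y \<omega> = (\<Sum>i\<in>{1..N}. indicator {..y} (V i \<omega>)) / real N" for y \<omega>
    define bad where "bad = {\<omega> \<in> space M. \<eta> <
      \<bar>cdf (empirical_measure N (normalized_wealth N (\<lambda>i. V i \<omega>))) z - F z\<bar>}"
    show "prob {\<omega> \<in> space M. \<eta> < \<bar>cdf (empirical_measure N (normalized_wealth N (\<lambda>i. V i \<omega>))) z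
        - cdf std_exponential z\<bar>} \<le> p N"
    proof (cases "N = 0")
      case True
      then show ?thesis
        \<comment> \<open>Here \<open>p 0 = 6\<close> exceeds every probability.\<close>
        by (simp add: p_def order_trans[OF prob_le_1])
    next
      case False
      then have N: "1 \<le> N" by simp
      define A where "A = {\<omega> \<in> space M. d * real N < \<bar>(\<Sum>i\<in>{1..N}. V i \<omega>) - real N\<bar>}"
      define B where "B y = {\<omega> \<in> space M.
        \<eta> / 2 \<le> \<bar>(\<Sum>i\<in>{1..N}. indicator {..y} (V i \<omega>)) / real N - cdf std_exponential y\<bar>}" for y
      have [measurable]: "A \<in> events" "B y \<in> events" for y
        unfolding A_def B_def by measurable
      have "bad \<subseteq> A \<union> B z1 \<union> B z2"
      proof (rule subsetI, rule ccontr)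
        fix \<omega> assume \<omega>: "\<omega> \<in> bad" "\<omega> \<notin> A \<union> B z1 \<union> B z2"
        then have "\<omega> \<in> space M" by (auto simp: bad_def)
        with \<omega> have S: "\<bar>S \<omega> - real N\<bar> \<le> d * real N"
          and C1: "\<bar>C z1 \<omega> - F z1\<bar> < \<eta> / 2" and C2: "\<bar>C z2 \<omega> - F z2\<bar> < \<eta> / 2"
          by (auto simp: A_def B_def S_def C_def F_def)
        have "(1 - d) * real N \<le> S \<omega>"
          using S by (simp add: abs_le_iff algebra_simps)
        moreover have "0 < (1 - d) * real N"
          using d N by simp
        ultimately have Spos: "0 < S \<omega>" by linarith
        have norm_le: "normalized_wealth N (\<lambda>i. V i \<omega>) i \<le> z \<longleftrightarrow> V i \<omega> \<le> z * (S \<omega> / real N)" for i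
          using Spos N by (simp add: normalized_wealth_def S_def field_simps)
        have "\<bar>S \<omega> / real N - 1\<bar> \<le> d"
          using S N by (simp add: abs_le_iff field_simps)
        then have "\<bar>z * (S \<omega> / real N) - z\<bar> \<le> \<bar>z\<bar> * d"
          by (metis abs_mult abs_ge_zero mult.right_neutral mult_left_mono right_diff_distrib)
        then have z12: "z1 \<le> z * (S \<omega> / real N)" "z * (S \<omega> / real N) \<le> z2"
          by (simp_all only: z1_def z2_def abs_diff_le_iff)
        define D where "D = cdf (empirical_measure N (normalized_wealth N (\<lambda>i. V i \<omega>))) z"
        have D: "D = (\<Sum>i\<in>{1..N}. indicator {..z} (normalized_wealth N (\<lambda>i. V i \<omega>) i)) / real N"
          by (simp add: D_def cdf_empirical_measure)
        have "C z1 \<omega> \<le> D"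
          unfolding C_def D using z12
          by (intro divide_right_mono sum_mono) (auto simp: indicator_def norm_le)
        moreover have "D \<le> C z2 \<omega>"
          unfolding C_def D using z12
          by (intro divide_right_mono sum_mono) (auto simp: indicator_def norm_le)
        ultimately have "\<bar>D - F z\<bar> \<le> \<eta>"
          using C1 C2 F1 F2 by (simp add: abs_if split: if_splits)
        with \<omega>(1) show False
          by (simp add: bad_def D_def)
      qed
      then have "prob bad \<le> prob (A \<union> B z1 \<union> B z2)"
        by (intro finite_measure_mono) auto
      also have "\<dots> \<le> prob (A \<union> B z1) + prob (B z2)"
        by (intro measure_Un_le) auto
      also have "\<dots> \<le> prob A + prob (B z1) + prob (B z2)"
        by (intro add_right_mono measure_Un_le) auto
      also have "\<dots> \<le> (((1 + d) * exp (- d)) ^ N + ((1 - d) * exp d) ^ N)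
          + 2 * exp (- 2 * real N * (\<eta> / 2)\<^sup>2) + 2 * exp (- 2 * real N * (\<eta> / 2)\<^sup>2)"
        unfolding A_def B_def using \<eta>
        by (intro add_mono exponential_mean_concentration[OF indep V d]
              empirical_count_concentration[OF indep V N]) auto
      also have "\<dots> = p N"
        by (simp add: p_def algebra_simps flip: exp_of_nat_mult)
      finally show ?thesis
        by (simp add: bad_def F_def)
    qed
  qed
qed

end

context prob_space begin

text \<open>Borel-Cantelli: the probabilities of deviations are summable.\<close>

lemma AE_cdf_empirical_tendsto:
  assumes indep: "\<And>N. indep_vars (\<lambda>_. borel) (U N) {1..N}"
    and U: "\<And>N i. i \<in> {1..N} \<Longrightarrow> distributed M lborel (U N i) (exponential_density 1)"
  shows "AE \<omega> in M. (\<lambda>N. cdf (empirical_measure N (normalized_wealth N (\<lambda>i. U N i \<omega>))) z)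
    \<longlonglongrightarrow> cdf std_exponential z"
proof -
  define D where "D N \<omega> = \<bar>cdf (empirical_measure N (normalized_wealth N (\<lambda>i. U N i \<omega>))) z - cdf std_exponential z\<bar>"
    for N \<omega>
  have [measurable]: "random_variable borel (U N i)" if "i \<in> {1..N}" for N i
    using distributed_measurable[OF U[OF that]] by simp
  have [measurable]: "random_variable borel (D N)" for N
    unfolding D_def cdf_empirical_measure normalized_wealth_def by measurable
  have pos: "0 < 1 / real (Suc m)" for m
    by simp
  have "AE \<omega> in M. \<forall>\<^sub>F N in sequentially. \<omega> \<in> space M - {\<omega> \<in> space M. 1 / real (Suc m) < D N \<omega>}" for m
  proof (rule borel_cantelli_AE1)
    obtain p where p: "summable p" "\<forall>N V. indep_vars (\<lambda>_. borel) V {1..N} \<longrightarrow>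
      (\<forall>i\<in>{1..N}. distributed M lborel (V i) (exponential_density 1)) \<longrightarrow>
      prob {\<omega> \<in> space M. 1 / real (Suc m) < \<bar>cdf (empirical_measure N (normalized_wealth N (\<lambda>i. V i \<omega>))) z
        - cdf std_exponential z\<bar>} \<le> p N"
      using normalized_empirical_cdf_concentration[OF pos, of m z] by blast
    have "prob {\<omega> \<in> space M. 1 / real (Suc m) < D N \<omega>} \<le> p N" for N
      unfolding D_def using p(2) indep U by blast
    then show "summable (\<lambda>N. prob {\<omega> \<in> space M. 1 / real (Suc m) < D N \<omega>})"
      by (intro summable_comparison_test'[OF p(1), of 0]) simp
  qed (auto simp: emeasure_eq_measure)
  then have "AE \<omega> in M. \<forall>m. \<forall>\<^sub>F N in sequentially. \<omega> \<in> space M - {\<omega> \<in> space M. 1 / real (Suc m) < D N \<omega>}"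
    by (simp add: AE_all_countable)
  then show ?thesis
  proof eventually_elim
    case (elim \<omega>)
    show ?case
    proof (rule tendstoI)
      fix e :: real assume "0 < e"
      then obtain m where m: "1 / real (Suc m) < e"
        using nat_approx_posE by blast
      show "\<forall>\<^sub>F N in sequentially. dist (cdf (empirical_measure N (normalized_wealth N (\<lambda>i. U N i \<omega>))) z)
          (cdf std_exponential z) < e"
        using elim[rule_format, of m] by eventually_elim (use m in \<open>auto simp: D_def dist_real_def not_less\<close>)
    qed
  qed
qed

end

text \<open>By monotonicity, the distribution function at a point of continuity of the limit is squeezed between
  its values at nearby rational points. Countably many points suffice, which permits a single null event.\<close>

lemma weak_conv_m_if_cdf_tendsto_on_rationals:
  assumes P: "\<forall>\<^sub>F n in sequentially. real_distribution (P n)" and Q: "real_distribution Q"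
    and lim: "\<And>q. q \<in> \<rat> \<Longrightarrow> (\<lambda>n. cdf (P n) q) \<longlonglongrightarrow> cdf Q q"
  shows "weak_conv_m P Q"
  unfolding weak_conv_m_def weak_conv_def
proof (intro allI impI tendstoI)
  fix x e :: real assume cont: "isCont (cdf Q) x" and e: "0 < e"
  then obtain d where d: "0 < d" "\<And>y. \<bar>y - x\<bar> < d \<Longrightarrow> \<bar>cdf Q y - cdf Q x\<bar> < e / 2"
    unfolding continuous_at_eps_delta by (metis dist_real_def half_gt_zero real_norm_def)
  obtain a where a: "a \<in> \<rat>" "x - d < a" "a < x"
    using Rats_dense_in_real[of "x - d" x] d(1) by auto
  obtain b where b: "b \<in> \<rat>" "x < b" "b < x + d"
    using Rats_dense_in_real[of x "x + d"] d(1) by auto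
  have "\<forall>\<^sub>F n in sequentially. dist (cdf (P n) a) (cdf Q a) < e / 2"
    "\<forall>\<^sub>F n in sequentially. dist (cdf (P n) b) (cdf Q b) < e / 2"
    using tendstoD[OF lim[OF a(1)], of "e / 2"] tendstoD[OF lim[OF b(1)], of "e / 2"] e by auto
  then show "\<forall>\<^sub>F n in sequentially. dist (cdf (P n) x) (cdf Q x) < e"
    using P
  proof eventually_elim
    case (elim n)
    interpret real_distribution "P n" by (rule elim(3))
    have "cdf (P n) a \<le> cdf (P n) x" "cdf (P n) x \<le> cdf (P n) b"
      using a b by (auto intro: cdf_nondecreasing)
    moreover have "\<bar>cdf Q a - cdf Q x\<bar> < e / 2" "\<bar>cdf Q b - cdf Q x\<bar> < e / 2"
      by (rule d(2), use a b in linarith)+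
    ultimately show ?case
      using elim(1,2) unfolding dist_real_def by linarith
  qed
qed


section \<open>Exchanges preserve independent exponential variables\<close>

text \<open>The sum \<open>s\<close> of two standard exponential variables has density \<open>s * exp (- s)\<close> on the half-line.
  For fixed \<open>s\<close>, the substitution \<open>x = r * s\<close> absorbs the factor \<open>s\<close>; then \<open>y = s - x\<close>
  turns \<open>exp (- s)\<close> into \<open>exp (- x) * exp (- y)\<close>.\<close>

lemma nn_integral_redistribution:
  fixes h :: "real \<Rightarrow> real \<Rightarrow> ennreal"
  assumes [measurable]: "(\<lambda>(x, y). h x y) \<in> borel_measurable (borel \<Otimes>\<^sub>M borel)"
  shows "(\<integral>\<^sup>+s. \<integral>\<^sup>+r. ennreal (erlang_density 1 1 s) * indicator {0..1} r * h (r * s) ((1 - r) * s) \<partial>lborel \<partial>lborel)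
    = (\<integral>\<^sup>+x. \<integral>\<^sup>+y. ennreal (exponential_density 1 x) * ennreal (exponential_density 1 y) * h x y \<partial>lborel \<partial>lborel)"
proof -
  define k where "k x s = ennreal (exp (- s)) * (indicator {0..} x * indicator {0..} (s - x) * h x (s - x))"
    for x s :: real
  have [measurable]: "(\<lambda>(x, y). k x y) \<in> borel_measurable (borel \<Otimes>\<^sub>M borel)"
    unfolding k_def by measurable
  have inner: "(\<integral>\<^sup>+r. ennreal (erlang_density 1 1 s) * indicator {0..1} r * h (r * s) ((1 - r) * s) \<partial>lborel)
      = (\<integral>\<^sup>+x. k x s \<partial>lborel)" if "s \<noteq> 0" for s
  proof (cases "s < 0")
    case True
    then have "k x s = 0" for x
      by (auto simp: k_def indicator_def)
    with True show ?thesis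
      by (simp add: erlang_density_def)
  next
    case False
    with that have s: "0 < s" by simp
    have "(\<integral>\<^sup>+x. k x s \<partial>lborel) = ennreal \<bar>s\<bar> * (\<integral>\<^sup>+r. k (0 + s * r) s \<partial>lborel)"
      using s by (intro nn_integral_real_affine) auto
    also have "\<dots> = (\<integral>\<^sup>+r. ennreal \<bar>s\<bar> * k (0 + s * r) s \<partial>lborel)"
      by (subst nn_integral_cmult) auto
    also have "\<dots> = (\<integral>\<^sup>+r. ennreal (erlang_density 1 1 s) * indicator {0..1} r * h (r * s) ((1 - r) * s) \<partial>lborel)"
    proof (intro nn_integral_cong)
      fix r :: real
      have "indicator {0..} (s * r) * indicator {0..} (s - s * r) = (indicator {0..1} r :: ennreal)"
        using s by (auto simp: indicator_def zero_le_mult_iff)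
      moreover have "s - s * r = (1 - r) * s" "s * r = r * s"
        by (simp_all add: algebra_simps)
      ultimately show "ennreal \<bar>s\<bar> * k (0 + s * r) s
          = ennreal (erlang_density 1 1 s) * indicator {0..1} r * h (r * s) ((1 - r) * s)"
        using s by (simp add: k_def erlang_density_def ennreal_mult mult_ac)
    qed
    finally show ?thesis ..
  qed
  have "(\<integral>\<^sup>+s. \<integral>\<^sup>+r. ennreal (erlang_density 1 1 s) * indicator {0..1} r * h (r * s) ((1 - r) * s) \<partial>lborel \<partial>lborel)
      = (\<integral>\<^sup>+s. \<integral>\<^sup>+x. k x s \<partial>lborel \<partial>lborel)"
    by (intro nn_integral_cong_AE eventually_mono[OF AE_lborel_singleton[of 0]] inner)
  also have "\<dots> = (\<integral>\<^sup>+x. \<integral>\<^sup>+s. k x s \<partial>lborel \<partial>lborel)"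
    by (intro lborel_pair.Fubini') simp
  also have "\<dots> = (\<integral>\<^sup>+x. \<integral>\<^sup>+y. ennreal (exponential_density 1 x) * ennreal (exponential_density 1 y) * h x y \<partial>lborel \<partial>lborel)"
  proof (rule nn_integral_cong)
    fix x :: real
    have "(\<integral>\<^sup>+s. k x s \<partial>lborel) = (\<integral>\<^sup>+y. k x (x + 1 * y) \<partial>lborel)"
      by (subst nn_integral_real_affine[where c = 1 and t = x]) auto
    also have "\<dots> = (\<integral>\<^sup>+y. ennreal (exponential_density 1 x) * ennreal (exponential_density 1 y) * h x y \<partial>lborel)"
      by (intro nn_integral_cong)
         (auto simp: k_def exponential_density_def indicator_def mult.assoc simp flip: ennreal_mult exp_add)
    finally show "(\<integral>\<^sup>+s. k x s \<partial>lborel)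
      = (\<integral>\<^sup>+y. ennreal (exponential_density 1 x) * ennreal (exponential_density 1 y) * h x y \<partial>lborel)" .
  qed
  finally show ?thesis .
qed

context prob_space begin

lemma distributed_uniform_01:
  assumes X: "random_variable borel X" and D: "distr M borel X = uniform_measure lborel {0..1::real}"
  shows "distributed M lborel X (indicator {0..1})"
proof -
  have "distr M lborel X = distr M borel X"
    by (intro distr_cong) auto
  also have "\<dots> = density lborel (\<lambda>x. indicator {0..1} x / emeasure lborel {0..1::real})"
    unfolding D uniform_measure_def ..
  also have "\<dots> = density lborel (indicator {0..1})"
    by (intro arg_cong[where f = "density lborel"]) (auto simp: fun_eq_iff indicator_def divide_ennreal_def)
  finally show ?thesis
    using X by (simp add: distributed_def)
qed

text \<open>The sum \<open>X a + X b\<close> and the splitting variable \<open>X c\<close> are independent, with an Erlang and a uniform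
  law; so the left-hand side is the integral evaluated by \<open>nn_integral_redistribution\<close>.\<close>

lemma redistribution_of_exponentials:
  assumes indep: "indep_vars (\<lambda>_. borel) X {a, b, c}" and abc: "a \<noteq> b" "a \<noteq> c" "b \<noteq> c"
    and Xa: "distributed M lborel (X a) (exponential_density 1)"
    and Xb: "distributed M lborel (X b) (exponential_density 1)"
    and Xc: "distr M borel (X c) = uniform_measure lborel {0..1}"
    and [measurable]: "A \<in> sets borel" "B \<in> sets borel"
  shows "prob {\<omega> \<in> space M. X c \<omega> * (X a \<omega> + X b \<omega>) \<in> A \<and> (1 - X c \<omega>) * (X a \<omega> + X b \<omega>) \<in> B}
    = measure (density lborel (exponential_density 1)) A * measure (density lborel (exponential_density 1)) B"
proof -
  let ?E = "density lborel (exponential_density 1)"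
  have [measurable]: "random_variable borel (X a)" "random_variable borel (X b)" "random_variable borel (X c)"
    using indep by (auto simp: indep_vars_def)
  have "indep_vars (\<lambda>_. borel) X (insert a {b})"
    by (rule indep_vars_subset[OF indep]) auto
  then have "indep_var borel (X a) borel (\<lambda>\<omega>. \<Sum>i\<in>{b}. X i \<omega>)"
    using abc by (intro indep_vars_sum) auto
  then have "distributed M lborel (\<lambda>\<omega>. X a \<omega> + X b \<omega>) (erlang_density (Suc 0 + Suc 0 - 1) 1)"
    using Xa Xb by (intro sum_indep_erlang) auto
  then have S: "distributed M lborel (\<lambda>\<omega>. X a \<omega> + X b \<omega>) (erlang_density 1 1)"
    by simp
  have "indep_var borel ((\<lambda>f. \<Sum>i\<in>{a, b}. f i) \<circ> (\<lambda>\<omega>. restrict (\<lambda>i. X i \<omega>) {a, b}))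
      borel ((\<lambda>f. f c) \<circ> (\<lambda>\<omega>. restrict (\<lambda>i. X i \<omega>) {c}))"
    using abc by (intro indep_var_compose[OF indep_var_restrict[OF indep]]) auto
  then have "indep_var borel (\<lambda>\<omega>. X a \<omega> + X b \<omega>) borel (X c)"
    using abc by (simp add: comp_def)
  then have ind: "indep_var lborel (\<lambda>\<omega>. X a \<omega> + X b \<omega>) lborel (X c)"
    by (simp add: indep_var_eq)
  have joint: "distributed M (lborel \<Otimes>\<^sub>M lborel) (\<lambda>\<omega>. (X a \<omega> + X b \<omega>, X c \<omega>))
      (\<lambda>(s, r). ennreal (erlang_density 1 1 s) * indicator {0..1} r)"
    using distributed_uniform_01[OF _ Xc] S ind
    by (intro distributed_joint_indep) (auto intro: sigma_finite_lborel)
  let ?g = "\<lambda>(s, r). indicator A (r * s) * indicator B ((1 - r) * s) :: ennreal"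
  have "emeasure M {\<omega> \<in> space M. X c \<omega> * (X a \<omega> + X b \<omega>) \<in> A \<and> (1 - X c \<omega>) * (X a \<omega> + X b \<omega>) \<in> B}
      = (\<integral>\<^sup>+\<omega>. indicator {\<omega> \<in> space M. X c \<omega> * (X a \<omega> + X b \<omega>) \<in> A \<and> (1 - X c \<omega>) * (X a \<omega> + X b \<omega>) \<in> B} \<omega> \<partial>M)"
    by simp
  also have "\<dots> = (\<integral>\<^sup>+\<omega>. ?g (X a \<omega> + X b \<omega>, X c \<omega>) \<partial>M)"
    by (intro nn_integral_cong) (auto simp: indicator_def)
  also have "\<dots> = (\<integral>\<^sup>+z. (case z of (s, r) \<Rightarrow> ennreal (erlang_density 1 1 s) * indicator {0..1} r) * ?g z \<partial>(lborel \<Otimes>\<^sub>M lborel))"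
    by (rule distributed_nn_integral[OF joint, symmetric]) measurable
  also have "\<dots> = (\<integral>\<^sup>+s. \<integral>\<^sup>+r. ennreal (erlang_density 1 1 s) * indicator {0..1} r *
      (indicator A (r * s) * indicator B ((1 - r) * s)) \<partial>lborel \<partial>lborel)"
    by (subst lborel.nn_integral_fst[symmetric]) (auto simp: split_beta')
  also have "\<dots> = (\<integral>\<^sup>+x. \<integral>\<^sup>+y. ennreal (exponential_density 1 x) * ennreal (exponential_density 1 y) *
      (indicator A x * indicator B y) \<partial>lborel \<partial>lborel)"
    by (rule nn_integral_redistribution) measurable
  also have "\<dots> = (\<integral>\<^sup>+x. \<integral>\<^sup>+y. (ennreal (exponential_density 1 x) * indicator A x) *
      (ennreal (exponential_density 1 y) * indicator B y) \<partial>lborel \<partial>lborel)"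
    by (simp add: mult_ac)
  also have "\<dots> = emeasure ?E A * emeasure ?E B"
    by (simp add: nn_integral_cmult nn_integral_multc emeasure_density)
  finally have eq: "emeasure M {\<omega> \<in> space M. X c \<omega> * (X a \<omega> + X b \<omega>) \<in> A \<and> (1 - X c \<omega>) * (X a \<omega> + X b \<omega>) \<in> B}
      = emeasure ?E A * emeasure ?E B" .
  show ?thesis
    unfolding measure_def eq enn2real_mult ..
qed

text \<open>The exchange acts on the block \<open>{a, b, c}\<close>, which is independent of the rest of the family, and consumes
  the splitting variable \<open>c\<close>. The remaining family has the properties that are assumed of the original
  one, so that the step can be iterated.\<close>

lemma redistribution_preserves_independence:
  assumes indep: "indep_vars (\<lambda>_. borel) X K" and K: "finite K"
    and abc: "a \<in> K" "b \<in> K" "c \<in> K" "a \<noteq> b" "a \<noteq> c" "b \<noteq> c"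
    and Xa: "distributed M lborel (X a) (exponential_density 1)"
    and Xb: "distributed M lborel (X b) (exponential_density 1)"
    and Xc: "distr M borel (X c) = uniform_measure lborel {0..1}"
  defines "Y \<equiv> X(a := \<lambda>\<omega>. X c \<omega> * (X a \<omega> + X b \<omega>), b := \<lambda>\<omega>. (1 - X c \<omega>) * (X a \<omega> + X b \<omega>))"
  shows "indep_vars (\<lambda>_. borel) Y (K - {c})"
    and "distributed M lborel (Y a) (exponential_density 1)"
    and "distributed M lborel (Y b) (exponential_density 1)"
proof -
  let ?E = "density lborel (exponential_density 1)"
  interpret E: prob_space ?E
    by (rule prob_space_exponential_density) simp
  have [measurable]: "random_variable borel (X i)" if "i \<in> K" for i
    using indep that by (auto simp: indep_vars_def)
  note [measurable] = this[OF abc(1)] this[OF abc(2)] this[OF abc(3)]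
  have Ya: "Y a = (\<lambda>\<omega>. X c \<omega> * (X a \<omega> + X b \<omega>))" and Yb: "Y b = (\<lambda>\<omega>. (1 - X c \<omega>) * (X a \<omega> + X b \<omega>))"
    and Yi: "i \<noteq> a \<Longrightarrow> i \<noteq> b \<Longrightarrow> Y i = X i" for i
    using abc by (auto simp: Y_def)
  have rv: "random_variable borel (Y i)" if "i \<in> K" for i
  proof -
    consider "i = a" | "i = b" | "i \<noteq> a" "i \<noteq> b" by blast
    then show ?thesis
      using that by cases (simp_all add: Ya Yb Yi)
  qed
  have "indep_vars (\<lambda>_. borel) X {a, b, c}"
    using abc by (intro indep_vars_subset[OF indep]) auto
  note pair = redistribution_of_exponentials[OF this abc(4-6) Xa Xb Xc]
  have pY: "prob (Y a -` A \<inter> space M \<inter> (Y b -` B \<inter> space M)) = measure ?E A * measure ?E B"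
    if "A \<in> sets borel" "B \<in> sets borel" for A B
  proof -
    have "Y a -` A \<inter> space M \<inter> (Y b -` B \<inter> space M)
        = {\<omega> \<in> space M. X c \<omega> * (X a \<omega> + X b \<omega>) \<in> A \<and> (1 - X c \<omega>) * (X a \<omega> + X b \<omega>) \<in> B}"
      by (auto simp: Ya Yb)
    then show ?thesis
      using pair[OF that] by simp
  qed
  have pa: "prob (Y a -` A \<inter> space M) = measure ?E A" if "A \<in> sets borel" for A
    using pY[OF that, of UNIV] E.prob_space by (simp add: Int_absorb2)
  have pb: "prob (Y b -` A \<inter> space M) = measure ?E A" if "A \<in> sets borel" for A
    using pY[of UNIV, OF _ that] E.prob_space by (simp add: Int_absorb1)
  have distributed: "distributed M lborel (Y i) (exponential_density 1)"
    if i: "i \<in> K" and p: "\<And>A. A \<in> sets borel \<Longrightarrow> prob (Y i -` A \<inter> space M) = measure ?E A" for i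
  proof -
    have "distr M lborel (Y i) = ?E"
      using rv[OF i] p
      by (intro measure_eqI) (auto simp: emeasure_distr emeasure_eq_measure E.emeasure_eq_measure)
    then show ?thesis
      using rv[OF i] by (simp add: distributed_def)
  qed
  show "distributed M lborel (Y a) (exponential_density 1)" "distributed M lborel (Y b) (exponential_density 1)"
    using distributed pa pb abc by auto
  define J where "J = K - {a, b, c}"
  have J: "finite J" "J \<subseteq> K" "a \<notin> J" "b \<notin> J" "c \<notin> J" and Kc: "K - {c} = insert a (insert b J)"
    using K abc by (auto simp: J_def)
  have YJ: "Y i = X i" if "i \<in> J" for i
    using that J by (intro Yi) auto
  have "(\<forall>A\<in>(\<Pi> i\<in>K - {c}. sets borel). prob (\<Inter>j\<in>K - {c}. Y j -` A j \<inter> space M)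
      = (\<Prod>j\<in>K - {c}. prob (Y j -` A j \<inter> space M)))"
  proof
    fix A :: "'b \<Rightarrow> real set" assume "A \<in> (\<Pi> i\<in>K - {c}. sets borel)"
    then have AJ: "A i \<in> sets borel" if "i \<in> J" for i
      using that Kc by auto
    have A[measurable]: "A a \<in> sets borel" "A b \<in> sets borel"
      using \<open>A \<in> _\<close> Kc by auto
    note [measurable] = AJ
    define Q where "Q = (\<Inter>j\<in>J. X j -` A j \<inter> space M) \<inter> space M"
    have PQ: "prob Q = (\<Prod>j\<in>J. prob (X j -` A j \<inter> space M))"
    proof (cases "J = {}")
      case True
      then show ?thesis by (simp add: Q_def prob_space)
    next
      case False
      then have "Q = (\<Inter>j\<in>J. X j -` A j \<inter> space M)"
        by (auto simp: Q_def)
      then show ?thesis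
        using indep_varsD[OF indep False J(1,2) AJ] by simp
    qed
    define f where "f = (\<lambda>z::'b \<Rightarrow> real. z c * (z a + z b) \<in> A a \<and> (1 - z c) * (z a + z b) \<in> A b)"
    define g where "g = (\<lambda>z::'b \<Rightarrow> real. \<forall>j\<in>J. z j \<in> A j)"
    have "indep_var (PiM {a, b, c} (\<lambda>_. borel)) (\<lambda>\<omega>. restrict (\<lambda>i. X i \<omega>) {a, b, c})
        (PiM J (\<lambda>_. borel)) (\<lambda>\<omega>. restrict (\<lambda>i. X i \<omega>) J)"
      using abc J by (intro indep_var_restrict[OF indep]) (auto simp: J_def)
    moreover have "f \<in> measurable (PiM {a, b, c} (\<lambda>_. borel)) (count_space UNIV)"
      unfolding f_def by measurable
    moreover have "g \<in> measurable (PiM J (\<lambda>_. borel)) (count_space UNIV)"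
      unfolding g_def using J(1) AJ
      by (intro pred_intros_finite(3)) auto
    ultimately have "indep_var (count_space UNIV) (f \<circ> (\<lambda>\<omega>. restrict (\<lambda>i. X i \<omega>) {a, b, c}))
        (count_space UNIV) (g \<circ> (\<lambda>\<omega>. restrict (\<lambda>i. X i \<omega>) J))"
      by (rule indep_var_compose)
    from indep_varD[OF this, of "{True}" "{True}"]
    have "prob (Y a -` A a \<inter> space M \<inter> (Y b -` A b \<inter> space M) \<inter> Q)
        = prob (Y a -` A a \<inter> space M \<inter> (Y b -` A b \<inter> space M)) * prob Q"
      by (simp add: f_def g_def Ya Yb Q_def vimage_def Int_def conj_ac cong: conj_cong)
    also have "\<dots> = prob (Y a -` A a \<inter> space M) * (prob (Y b -` A b \<inter> space M) * (\<Prod>j\<in>J. prob (Y j -` A j \<inter> space M)))"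
      by (simp add: pY pa pb PQ A YJ)
    also have "Y a -` A a \<inter> space M \<inter> (Y b -` A b \<inter> space M) \<inter> Q = (\<Inter>j\<in>K - {c}. Y j -` A j \<inter> space M)"
      unfolding Kc by (auto simp: YJ Q_def)
    finally show "prob (\<Inter>j\<in>K - {c}. Y j -` A j \<inter> space M) = (\<Prod>j\<in>K - {c}. prob (Y j -` A j \<inter> space M))"
      unfolding Kc using J abc by simp
  qed
  then show "indep_vars (\<lambda>_. borel) Y (K - {c})"
    using abc K rv
    by (subst indep_vars_finite[where E = "\<lambda>_. sets borel"])
       (auto simp: Int_stable_def sets.sigma_sets_eq[of borel, simplified])
qed

end


section \<open>The dynamics along a chronological list of interactions\<close>

text \<open>Agents \<open>i\<close>, \<open>j\<close> and the number \<open>k\<close> of the ring of their clock.\<close>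

definition interactions :: "nat \<Rightarrow> (nat \<times> nat \<times> nat) set" where
  "interactions N = {(i, j, k). i \<in> {1..N} \<and> j \<in> {1..N} \<and> i \<noteq> j}"

definition replay :: "(nat \<times> nat \<times> nat) list \<Rightarrow> (noise_source \<Rightarrow> real) \<Rightarrow> nat \<Rightarrow> real" where
  "replay l h = fold (\<lambda>(i, j, k). exchange i j (h (Split i j k))) l (\<lambda>i. h (Initial i))"

text \<open>Together with \<open>gap_sources\<close> below: the two disjoint groups of variables whose independence separates what happens at the interactions
  from their chronological order.\<close>

definition replay_sources :: "nat \<Rightarrow> noise_source set" where
  "replay_sources N = Initial ` {1..N} \<union> (\<lambda>(i, j, k). Split i j k) ` interactions N"

definition gap_sources :: "nat \<Rightarrow> noise_source set" where
  "gap_sources N = (\<lambda>(i, j, k). Gap i j k) ` interactions N"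

text \<open>The list \<open>l\<close> is the chronological list of the interactions up to time \<open>t\<close>. If infinitely many clocks
  have rung, then this list is \<open>[]\<close> by the convention of \<open>sorted_key_list_of_set\<close>. Infinity is
  expressed by a quantifier over the countable type of lists, so that its measurability is immediate.\<close>

definition rings_in_order ::
  "nat \<Rightarrow> (nat \<Rightarrow> nat \<Rightarrow> nat \<Rightarrow> real) \<Rightarrow> real \<Rightarrow> (nat \<times> nat \<times> nat) list \<Rightarrow> bool" where
  "rings_in_order N g t l \<longleftrightarrow>
     rings_until N g t = set l \<and> sorted_wrt (<) (map (ring_time g) l) \<or>
     l = [] \<and> (\<forall>l'. rings_until N g t \<noteq> set l')"

lemma rings_until_subset: "rings_until N g t \<subseteq> interactions N"
  by (auto simp: rings_until_def interactions_def)

lemma mem_rings_until: "x \<in> rings_until N g t \<longleftrightarrow> x \<in> interactions N \<and> ring_time g x \<le> t"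
  by (auto simp: rings_until_def interactions_def split: prod.splits)

lemma sorted_key_list_of_set_infinite:
  "infinite A \<Longrightarrow> sorted_key_list_of_set f A = []"
  for f :: "'b \<Rightarrow> 'c::linorder"
  by (simp add: sorted_key_list_of_set_def folding_on.eq_fold[of "{}"] folding_on_def)

text \<open>The list function of the locale for linear orders, taken at the order of a type, agrees with
  that of the type class. This carries the facts about the locale over to \<open>wealth_at\<close>.\<close>

lemma linorder_sorted_key_list_of_set:
  "linorder.sorted_key_list_of_set (\<le>) = (sorted_key_list_of_set :: ('b \<Rightarrow> 'c::linorder) \<Rightarrow> _)"
  by (simp add: fun_eq_iff linorder.sorted_key_list_of_set_def[OF linorder_class.linorder_axioms]
      sorted_key_list_of_set_def linorder.insort_key_def[OF linorder_class.linorder_axioms] insort_key_def)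

lemma rings_in_order_unique:
  assumes "rings_in_order N g t l"
  shows "sorted_key_list_of_set (ring_time g) (rings_until N g t) = l" "distinct l" "set l \<subseteq> interactions N"
proof -
  consider (fin) "rings_until N g t = set l" "sorted_wrt (<) (map (ring_time g) l)"
    | (inf) "l = []" "infinite (rings_until N g t)"
    using assms finite_list[of "rings_until N g t"] by (auto simp: rings_in_order_def)
  then have "sorted_key_list_of_set (ring_time g) (rings_until N g t) = l \<and> distinct l \<and> set l \<subseteq> interactions N"
  proof cases
    case fin
    then have s: "sorted (map (ring_time g) l)" and d: "distinct (map (ring_time g) l)"
      by (simp_all add: strict_sorted_iff)
    interpret folding_insort_key "(\<le>)" "(<)" "set l" "ring_time g"
      using d by unfold_locales (simp add: distinct_map)
    show ?thesis
      using fin s d idem_if_sorted_distinct[of l] rings_until_subset[of N g t]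
      by (auto simp: distinct_map linorder_sorted_key_list_of_set)
  next
    case inf
    then show ?thesis
      by (simp add: sorted_key_list_of_set_infinite)
  qed
  then show "sorted_key_list_of_set (ring_time g) (rings_until N g t) = l" "distinct l" "set l \<subseteq> interactions N"
    by auto
qed

text \<open>Existence complements the uniqueness above: on the event of distinct ring times, the chronological
  list is a random variable with countably many values.\<close>

lemma ex_rings_in_order:
  assumes "inj_on (ring_time g) (interactions N)"
  obtains l where "rings_in_order N g t l"
proof (cases "finite (rings_until N g t)")
  case True
  interpret folding_insort_key "(\<le>)" "(<)" "interactions N" "ring_time g"
    using assms by unfold_locales
  obtain l where "sorted_wrt (<) (map (ring_time g) l)" "set l = rings_until N g t"
    using finite_set_strict_sorted[OF rings_until_subset True] by metis
  then show ?thesis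
    by (intro that[of l]) (simp add: rings_in_order_def)
next
  case False
  then show ?thesis
    by (intro that[of "[]"]) (auto simp: rings_in_order_def)
qed

lemma rings_in_order_cong:
  assumes "\<And>x. x \<in> interactions N \<Longrightarrow> ring_time g x = ring_time g' x"
    and "set l \<subseteq> interactions N"
  shows "rings_in_order N g t l = rings_in_order N g' t l"
proof -
  have "rings_until N g t = rings_until N g' t"
    using assms(1) by (auto simp: mem_rings_until set_eq_iff simp del: split_paired_All)
  moreover have "map (ring_time g) l = map (ring_time g') l"
    using assms by auto
  ultimately show ?thesis
    by (simp only: rings_in_order_def)
qed

lemma measurable_rings_in_order:
  assumes l: "set l \<subseteq> interactions N"
  shows "(\<lambda>h. rings_in_order N (\<lambda>i j k. h (Gap i j k)) t l)
    \<in> measurable (PiM (gap_sources N) (\<lambda>_. borel)) (count_space UNIV)"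
proof -
  let ?g = "\<lambda>h i j k. h (Gap i j k) :: real"
  let ?P = "PiM (gap_sources N) (\<lambda>_. borel :: real measure)"
  have T: "(\<lambda>h. ring_time (?g h) x) \<in> borel_measurable ?P" if "x \<in> interactions N" for x
  proof -
    obtain i j k where x: "x = (i, j, k)" by (cases x)
    have "Gap i j m \<in> gap_sources N" for m
      using that by (force simp: x gap_sources_def interactions_def)
    then show ?thesis
      by (auto simp: x ring_time_def intro!: borel_measurable_sum measurable_component_singleton)
  qed
  have R[measurable]: "Measurable.pred ?P (\<lambda>h. x \<in> rings_until N (?g h) t)" for x
    using T[of x] by (cases "x \<in> interactions N") (auto simp: mem_rings_until)
  have S: "Measurable.pred ?P (\<lambda>h. rings_until N (?g h) t = set l')" for l'
    unfolding set_eq_iff by measurable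
  note [measurable] = S
  have "Measurable.pred ?P (\<lambda>h. a < b \<longrightarrow> b < length l \<longrightarrow>
      ring_time (?g h) (l ! a) < ring_time (?g h) (l ! b))" for a b
  proof (cases "a < b \<and> b < length l")
    case True
    then have [measurable]: "(\<lambda>h. ring_time (?g h) (l ! a)) \<in> borel_measurable ?P"
      "(\<lambda>h. ring_time (?g h) (l ! b)) \<in> borel_measurable ?P"
      using l by (auto intro!: T)
    show ?thesis by measurable
  qed auto
  then have nth: "Measurable.pred ?P (\<lambda>h. \<forall>a b. a < b \<longrightarrow> b < length l \<longrightarrow>
      ring_time (?g h) (l ! a) < ring_time (?g h) (l ! b))"
    by (intro pred_intros_countable)
  have sorted_nth: "sorted_wrt (<) (map (ring_time (?g h)) l) \<longleftrightarrow> (\<forall>a b. a < b \<longrightarrow> b < length l \<longrightarrow>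
      ring_time (?g h) (l ! a) < ring_time (?g h) (l ! b))" for h
    unfolding sorted_wrt_map by (rule sorted_wrt_iff_nth_less)
  have [measurable]: "Measurable.pred ?P (\<lambda>h. sorted_wrt (<) (map (ring_time (?g h)) l))"
    unfolding sorted_nth by (rule nth)
  show ?thesis
    unfolding rings_in_order_def by measurable
qed

lemma replay_Nil: "replay [] h = (\<lambda>i. h (Initial i))"
  by (simp add: replay_def)

lemma replay_snoc: "replay (l @ [(i, j, k)]) h = exchange i j (h (Split i j k)) (replay l h)"
  by (simp add: replay_def)

lemma replay_cong:
  assumes "set l \<subseteq> interactions N" "\<And>s. s \<in> replay_sources N \<Longrightarrow> h s = h' s" "n \<in> {1..N}"
  shows "replay l h n = replay l h' n"
  using assms(1,3)
proof (induction l arbitrary: n rule: rev_induct)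
  case Nil
  then show ?case
    using assms(2)[of "Initial n"] by (auto simp: replay_Nil replay_sources_def)
next
  case (snoc x l)
  obtain i j k where x: "x = (i, j, k)" by (cases x)
  have ijk: "(i, j, k) \<in> interactions N"
    using snoc.prems x by auto
  then have "h (Split i j k) = h' (Split i j k)"
    by (intro assms(2)) (force simp: replay_sources_def)
  then show ?case
    using snoc ijk unfolding x replay_snoc exchange_def
    by (auto simp: interactions_def)
qed

lemma measurable_replay:
  assumes "set l \<subseteq> interactions N" "n \<in> {1..N}"
  shows "(\<lambda>h. replay l h n) \<in> borel_measurable (PiM (replay_sources N) (\<lambda>_. borel))"
  using assms
proof (induction l arbitrary: n rule: rev_induct)
  case Nil
  then show ?case
    by (auto simp: replay_Nil replay_sources_def intro!: measurable_component_singleton)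
next
  case (snoc x l)
  obtain i j k where x: "x = (i, j, k)" by (cases x)
  have ijk: "(i, j, k) \<in> interactions N"
    using snoc.prems x by auto
  then have "Split i j k \<in> replay_sources N"
    by (force simp: replay_sources_def)
  then have [measurable]: "(\<lambda>h. h (Split i j k)) \<in> borel_measurable (PiM (replay_sources N) (\<lambda>_. borel))"
    by (rule measurable_component_singleton)
  have [measurable]: "(\<lambda>h. replay l h i) \<in> borel_measurable (PiM (replay_sources N) (\<lambda>_. borel))"
    "(\<lambda>h. replay l h j) \<in> borel_measurable (PiM (replay_sources N) (\<lambda>_. borel))"
    "(\<lambda>h. replay l h n) \<in> borel_measurable (PiM (replay_sources N) (\<lambda>_. borel))"
    using snoc ijk by (auto simp: interactions_def)
  have "i \<noteq> j"
    using ijk by (auto simp: interactions_def)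
  then show ?case
    unfolding x replay_snoc exchange_def by (cases "n = j"; cases "n = i") simp_all
qed

lemma fold_exchange_scale:
  "fold (\<lambda>(i, j, k). exchange i j (r i j k)) l (\<lambda>i. c * x i)
    = (\<lambda>i. c * fold (\<lambda>(i, j, k). exchange i j (r i j k)) l x i)"
proof (induction l arbitrary: x)
  case (Cons a l)
  obtain i j k where a: "a = (i, j, k)" by (cases a)
  have "exchange i j (r i j k) (\<lambda>i. c * x i) = (\<lambda>n. c * exchange i j (r i j k) x n)"
    by (auto simp: exchange_def fun_eq_iff algebra_simps)
  then show ?case
    using Cons by (simp add: a)
qed simp

lemma sum_exchange:
  assumes "i \<in> A" "j \<in> A" "i \<noteq> j" "finite A"
  shows "sum (exchange i j r x) A = sum x A"
proof -
  have A: "A = insert i (insert j (A - {i, j}))"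
    using assms by auto
  have "sum (exchange i j r x) (A - {i, j}) = sum x (A - {i, j})"
    by (intro sum.cong) (auto simp: exchange_def)
  then have "sum (exchange i j r x) (insert i (insert j (A - {i, j}))) = sum x (insert i (insert j (A - {i, j})))"
    using assms by (simp add: exchange_def algebra_simps)
  then show ?thesis
    using A by simp
qed

lemma sum_fold_exchange:
  assumes "set l \<subseteq> interactions N"
  shows "sum (fold (\<lambda>(i, j, k). exchange i j (r i j k)) l x) {1..N} = sum x {1..N}"
  using assms
proof (induction l arbitrary: x)
  case (Cons a l)
  obtain i j k where a: "a = (i, j, k)" by (cases a)
  show ?case
    using Cons by (simp add: a sum_exchange interactions_def)
qed simp

text \<open>Exchanges are linear in the wealth and conserve the total, so they commute with the normalization.
  This reduces the dynamics from the normalized wealth, whose entries are dependent, to independent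
  variables.\<close>

lemma fold_exchange_normalized_wealth:
  assumes "set l \<subseteq> interactions N"
  shows "fold (\<lambda>(i, j, k). exchange i j (r i j k)) l (normalized_wealth N u)
    = normalized_wealth N (fold (\<lambda>(i, j, k). exchange i j (r i j k)) l u)"
proof -
  have "normalized_wealth N v = (\<lambda>i. (real N / sum v {1..N}) * v i)" for v
    by (simp add: fun_eq_iff normalized_wealth_def)
  then show ?thesis
    using sum_fold_exchange[OF assms, of r u] by (simp only: fold_exchange_scale)
qed

context prob_space begin

text \<open>Independence refers to finitely many indices at a time, so it is inherited along injections.\<close>

lemma indep_vars_reindex:
  assumes indep: "indep_vars M' X (f ` I)" and f: "inj_on f I"
  shows "indep_vars (\<lambda>i. M' (f i)) (\<lambda>i. X (f i)) I"
  unfolding indep_vars_def2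
proof
  show "\<forall>i\<in>I. random_variable (M' (f i)) (X (f i))"
    using indep by (auto simp: indep_vars_def2)
  have sets: "indep_sets (\<lambda>s. {X s -` A \<inter> space M |A. A \<in> sets (M' s)}) (f ` I)"
    using indep by (auto simp: indep_vars_def2)
  show "indep_sets (\<lambda>i. {X (f i) -` A \<inter> space M |A. A \<in> sets (M' (f i))}) I"
  proof (rule indep_setsI)
    show "{X (f i) -` A \<inter> space M |A. A \<in> sets (M' (f i))} \<subseteq> events" if "i \<in> I" for i
      using sets that by (auto simp: indep_sets_def)
    fix A J assume J: "J \<noteq> {}" "J \<subseteq> I" "finite J"
      and A: "\<forall>j\<in>J. A j \<in> {X (f j) -` A \<inter> space M |A. A \<in> sets (M' (f j))}"
    have inv: "inv_into I f (f j) = j" if "j \<in> J" for j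
      using that J f by auto
    have "prob (\<Inter>s\<in>f ` J. A (inv_into I f s)) = (\<Prod>s\<in>f ` J. prob (A (inv_into I f s)))"
      using J A inv by (intro indep_setsD[OF sets]) auto
    moreover have "(\<Inter>s\<in>f ` J. A (inv_into I f s)) = (\<Inter>j\<in>J. A j)"
      using inv by auto
    moreover have "(\<Prod>s\<in>f ` J. prob (A (inv_into I f s))) = (\<Prod>j\<in>J. prob (A j))"
      using inv J f by (subst prod.reindex) (auto intro: inj_on_subset)
    ultimately show "prob (\<Inter>j\<in>J. A j) = (\<Prod>j\<in>J. prob (A j))"
      by simp
  qed
qed

text \<open>A fixed list of distinct interactions uses each splitting variable at most once. Hence every exchange in
  turn meets a splitting variable that is independent of the current wealth.\<close>

lemma replay_iid_exponential:
  assumes "indep_vars (\<lambda>_. borel) X (Initial ` {1..N} \<union> (\<lambda>(i, j, k). Split i j k) ` set l)"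
    and "distinct l" "set l \<subseteq> interactions N"
    and "\<And>n. n \<in> {1..N} \<Longrightarrow> distributed M lborel (X (Initial n)) (exponential_density 1)"
    and "\<And>i j k. (i, j, k) \<in> set l \<Longrightarrow> distr M borel (X (Split i j k)) = uniform_measure lborel {0..1}"
  shows "indep_vars (\<lambda>_. borel) (\<lambda>n \<omega>. replay l (\<lambda>s. X s \<omega>) n) {1..N} \<and>
    (\<forall>n\<in>{1..N}. distributed M lborel (\<lambda>\<omega>. replay l (\<lambda>s. X s \<omega>) n) (exponential_density 1))"
  using assms
proof (induction l arbitrary: X)
  case Nil
  then show ?case
    using indep_vars_reindex[of "\<lambda>_. borel" X Initial "{1..N}"] by (simp add: replay_Nil inj_on_def)
next
  case (Cons x l)
  obtain i j k where x: "x = (i, j, k)" by (cases x)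
  have ij: "i \<in> {1..N}" "j \<in> {1..N}" "i \<noteq> j"
    using Cons.prems(3) by (auto simp: x interactions_def)
  define K where "K = Initial ` {1..N} \<union> (\<lambda>(i, j, k). Split i j k) ` set (x # l)"
  define Y where "Y = X(Initial i := \<lambda>\<omega>. X (Split i j k) \<omega> * (X (Initial i) \<omega> + X (Initial j) \<omega>),
    Initial j := \<lambda>\<omega>. (1 - X (Split i j k) \<omega>) * (X (Initial i) \<omega> + X (Initial j) \<omega>))"
  have indepK: "indep_vars (\<lambda>_. borel) X K"
    unfolding K_def by (rule Cons.prems(1))
  have mem: "Initial i \<in> K" "Initial j \<in> K" "Split i j k \<in> K" "finite K"
    using ij by (auto simp: K_def x)
  have unif: "distr M borel (X (Split i j k)) = uniform_measure lborel {0..1}"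
    using Cons.prems(5) by (simp add: x)
  note pres = redistribution_preserves_independence[OF indepK mem(4,1,2,3) _ _ _
      Cons.prems(4)[OF ij(1)] Cons.prems(4)[OF ij(2)] unif, folded Y_def]
  have K': "K - {Split i j k} = Initial ` {1..N} \<union> (\<lambda>(i, j, k). Split i j k) ` set l"
    using Cons.prems(2) by (auto simp: K_def x)
  have step: "indep_vars (\<lambda>_. borel) (\<lambda>n \<omega>. replay l (\<lambda>s. Y s \<omega>) n) {1..N} \<and>
    (\<forall>n\<in>{1..N}. distributed M lborel (\<lambda>\<omega>. replay l (\<lambda>s. Y s \<omega>) n) (exponential_density 1))"
  proof (rule Cons.IH)
    show "indep_vars (\<lambda>_. borel) Y (Initial ` {1..N} \<union> (\<lambda>(i, j, k). Split i j k) ` set l)"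
      using pres(1) ij unfolding K' by simp
    show "distributed M lborel (Y (Initial n)) (exponential_density 1)" if "n \<in> {1..N}" for n
    proof -
      consider "n = i" | "n = j" | "n \<noteq> i" "n \<noteq> j" by blast
      then show ?thesis
      proof cases
        case 3
        then have "Y (Initial n) = X (Initial n)" by (simp add: Y_def)
        then show ?thesis using Cons.prems(4)[OF that] by simp
      qed (use pres(2,3) ij in simp_all)
    qed
    show "distr M borel (Y (Split i' j' k')) = uniform_measure lborel {0..1}"
      if "(i', j', k') \<in> set l" for i' j' k'
      using Cons.prems(5)[of i' j' k'] that by (simp add: Y_def)
  qed (use Cons.prems(2,3) in auto)
  have eq: "replay (x # l) (\<lambda>s. X s \<omega>) = replay l (\<lambda>s. Y s \<omega>)" for \<omega>
  proof -
    have "exchange i j (X (Split i j k) \<omega>) (\<lambda>i. X (Initial i) \<omega>) = (\<lambda>i. Y (Initial i) \<omega>)"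
      by (auto simp: exchange_def Y_def fun_eq_iff)
    moreover have "Y (Split i j k) = X (Split i j k)" for i j k
      by (simp add: Y_def)
    ultimately show ?thesis
      by (simp add: replay_def x)
  qed
  show ?case
    unfolding eq by (rule step)
qed

end


section \<open>Interactions occur at distinct times\<close>

context prob_space begin

text \<open>Given \<open>T\<close>, the variable \<open>X\<close> would have to take the single value \<open>- T\<close>; its law has no atoms.\<close>

lemma AE_indep_sum_neq_0:
  assumes X: "distributed M lborel X f" and indep: "indep_var borel X borel T"
  shows "AE \<omega> in M. X \<omega> + T \<omega> \<noteq> (0::real)"
proof -
  have [measurable]: "random_variable borel X" "random_variable borel T"
    using indep by (auto simp: indep_var_eq)
  interpret X: prob_space "distr M borel X" by (rule prob_space_distr) simp
  interpret T: prob_space "distr M borel T" by (rule prob_space_distr) simp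
  interpret P: pair_prob_space "distr M borel X" "distr M borel T" ..
  have null: "emeasure (distr M borel X) {y} = 0" for y
  proof -
    have "emeasure (distr M borel X) {y} = emeasure (distr M lborel X) {y}"
      by (simp add: emeasure_distr)
    also have "\<dots> = emeasure (density lborel f) {y}"
      using distributed_distr_eq_density[OF X] by simp
    also have "\<dots> = 0"
      using distributed_borel_measurable[OF X]
      by (intro absolutely_continuousI_density[unfolded absolutely_continuous_def, THEN subsetD, THEN null_setsD1]) auto
    finally show ?thesis .
  qed
  let ?Q = "{z \<in> space (borel \<Otimes>\<^sub>M borel). fst z + snd z = (0::real)}"
  have Q: "?Q \<in> sets (borel \<Otimes>\<^sub>M borel)"
    by measurable
  have "emeasure M {\<omega> \<in> space M. X \<omega> + T \<omega> = 0} = emeasure (distr M (borel \<Otimes>\<^sub>M borel) (\<lambda>\<omega>. (X \<omega>, T \<omega>))) ?Q"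
    using Q by (subst emeasure_distr) (auto intro!: arg_cong[where f = "emeasure M"] simp: space_pair_measure)
  also have "\<dots> = emeasure (distr M borel X \<Otimes>\<^sub>M distr M borel T) ?Q"
    using indep by (simp add: indep_var_distribution_eq)
  also have "\<dots> = (\<integral>\<^sup>+y. emeasure (distr M borel X) ((\<lambda>x. (x, y)) -` ?Q) \<partial>distr M borel T)"
    using Q by (intro P.emeasure_pair_measure_alt2) simp
  also have "\<dots> = (\<integral>\<^sup>+y. emeasure (distr M borel X) {- y} \<partial>distr M borel T)"
    by (intro nn_integral_cong arg_cong[where f = "emeasure _"]) (auto simp: space_pair_measure)
  also have "\<dots> = 0"
    by (simp add: null)
  finally have "emeasure M {\<omega> \<in> space M. X \<omega> + T \<omega> = 0} = 0" .
  then show ?thesis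
    by (intro AE_I[of _ _ "{\<omega> \<in> space M. X \<omega> + T \<omega> = 0}"]) auto
qed

text \<open>Solve the equation for the variable that occurs on one side only: it is independent of the others.\<close>

lemma AE_sum_neq_sum_aux:
  fixes X :: "'i \<Rightarrow> 'a \<Rightarrow> real"
  assumes indep: "indep_vars (\<lambda>_. borel) X (A \<union> B)" and fin: "finite A" "finite B"
    and a: "a \<in> A" "a \<notin> B" and X: "distributed M lborel (X a) f"
  shows "AE \<omega> in M. (\<Sum>s\<in>A. X s \<omega>) \<noteq> (\<Sum>s\<in>B. X s \<omega>)"
proof -
  define J where "J = A \<union> B - {a}"
  have J: "finite J" "a \<notin> J" and AB: "A \<union> B = insert a J"
    using fin a by (auto simp: J_def)
  define c :: "'i \<Rightarrow> real" where "c s = (if s = a then 1 else indicator A s - indicator B s)" for s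
  have "indep_vars (\<lambda>_. borel) (\<lambda>s \<omega>. c s * X s \<omega>) (insert a J)"
    using indep unfolding AB by (rule indep_vars_compose2[where Y = "\<lambda>s x. c s * x"]) auto
  from indep_vars_sum[OF J this]
  have "indep_var borel (X a) borel (\<lambda>\<omega>. \<Sum>s\<in>J. c s * X s \<omega>)"
    by (simp add: c_def)
  from AE_indep_sum_neq_0[OF X this] show ?thesis
  proof eventually_elim
    case (elim \<omega>)
    have "(\<Sum>s\<in>A. X s \<omega>) - (\<Sum>s\<in>B. X s \<omega>) = (\<Sum>s\<in>A \<union> B. (indicator A s - indicator B s) * X s \<omega>)"
      using fin by (simp add: left_diff_distrib sum_subtractf sum.If_cases Int_absorb1 indicator_def
        if_distrib[where f = "\<lambda>x. x * _"] cong: if_cong)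
    also have "\<dots> = X a \<omega> + (\<Sum>s\<in>J. (indicator A s - indicator B s) * X s \<omega>)"
      unfolding AB using J a by simp
    also have "(\<Sum>s\<in>J. (indicator A s - indicator B s) * X s \<omega>) = (\<Sum>s\<in>J. c s * X s \<omega>)"
      using J by (intro sum.cong) (auto simp: c_def)
    finally show ?case
      using elim by simp
  qed
qed

lemma AE_sum_neq_sum:
  fixes X :: "'i \<Rightarrow> 'a \<Rightarrow> real"
  assumes indep: "indep_vars (\<lambda>_. borel) X (A \<union> B)" and fin: "finite A" "finite B" and "A \<noteq> B"
    and X: "\<And>s. s \<in> A \<union> B \<Longrightarrow> distributed M lborel (X s) f"
  shows "AE \<omega> in M. (\<Sum>s\<in>A. X s \<omega>) \<noteq> (\<Sum>s\<in>B. X s \<omega>)"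
proof -
  from \<open>A \<noteq> B\<close> consider a where "a \<in> A" "a \<notin> B" | a where "a \<in> B" "a \<notin> A"
    by auto
  then show ?thesis
  proof cases
    case (1 a)
    then show ?thesis
      using AE_sum_neq_sum_aux[OF indep fin] X by auto
  next
    case (2 a)
    have "AE \<omega> in M. (\<Sum>s\<in>B. X s \<omega>) \<noteq> (\<Sum>s\<in>A. X s \<omega>)"
      using AE_sum_neq_sum_aux[of X B A] indep fin 2 X by (auto simp: Un_commute)
    then show ?thesis
      by eventually_elim auto
  qed
qed

end


section \<open>The wealth at a fixed time\<close>

context prob_space begin

text \<open>The ring times of two different interactions are sums of gaps over two different sets of indices,
  and the gaps are independent with a density; two such sums differ almost surely.\<close>

lemma AE_inj_on_ring_time:
  assumes dyn: "exchange_dynamics M N u g r"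
  shows "AE \<omega> in M. inj_on (ring_time (\<lambda>i j k. g i j k \<omega>)) (interactions N)"
proof -
  define X where "X s = (case s of Initial i \<Rightarrow> u i | Gap i j k \<Rightarrow> g i j k | Split i j k \<Rightarrow> r i j k)" for s
  have indep: "indep_vars (\<lambda>_. borel) X (noise_sources N)"
    using dyn by (simp add: exchange_dynamics_def X_def[abs_def])
  have sum: "ring_time (\<lambda>i j k. g i j k \<omega>) (i, j, k) = (\<Sum>s\<in>Gap i j ` {..k}. X s \<omega>)" for i j k \<omega>
    by (subst sum.reindex) (auto simp: ring_time_def X_def inj_on_def)
  have neq: "AE \<omega> in M. ring_time (\<lambda>i j k. g i j k \<omega>) x \<noteq> ring_time (\<lambda>i j k. g i j k \<omega>) y"
    if "x \<in> interactions N" "y \<in> interactions N" "x \<noteq> y" for x y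
  proof -
    obtain i j k i' j' k' where x: "x = (i, j, k)" and y: "y = (i', j', k')"
      by (cases x, cases y)
    let ?A = "Gap i j ` {..k}" and ?B = "Gap i' j' ` {..k'}"
    have "?A \<noteq> ?B"
    proof
      assume eq: "?A = ?B"
      have "Gap i j k \<in> ?B" "Gap i' j' k' \<in> ?A"
        by (simp_all flip: eq) (simp add: eq)
      then show False
        using \<open>x \<noteq> y\<close> by (auto simp: x y)
    qed
    moreover have "?A \<union> ?B \<subseteq> noise_sources N"
      using that by (auto simp: x y interactions_def noise_sources_def)
    moreover have "distributed M lborel (X s) (exponential_density (1 / real N))" if "s \<in> ?A \<union> ?B" for s
      using that dyn \<open>x \<in> _\<close> \<open>y \<in> _\<close> by (auto simp: x y exchange_dynamics_def interactions_def X_def)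
    ultimately show ?thesis
      unfolding x y sum by (intro AE_sum_neq_sum indep_vars_subset[OF indep]) auto
  qed
  have "AE \<omega> in M. \<forall>x y. x \<in> interactions N \<longrightarrow> y \<in> interactions N \<longrightarrow> x \<noteq> y \<longrightarrow>
      ring_time (\<lambda>i j k. g i j k \<omega>) x \<noteq> ring_time (\<lambda>i j k. g i j k \<omega>) y"
    unfolding AE_all_countable using neq by (auto simp del: split_paired_All)
  then show ?thesis
    unfolding inj_on_def by eventually_elim blast
qed

text \<open>Decompose according to the chronological list \<open>l\<close> of the interactions up to time \<open>t\<close>. Which list occurs
  (the event \<open>E l\<close>) is decided by the clocks, which are independent of the initial wealth and of the
  splitting variables, and so of the event \<open>D l\<close> that replaying \<open>l\<close> leads to a deviation. For a fixed
  \<open>l\<close> the replayed wealth consists of independent exponential variables. Hence the probability of a deviation at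
  time \<open>t\<close> is an average over \<open>l\<close> of probabilities that are at most \<open>p\<close>. The conclusion is stated
  with a measurable cover \<open>B\<close> because the state is unspecified on a null event.\<close>

lemma exchange_dynamics_deviation:
  fixes g r :: "nat \<Rightarrow> nat \<Rightarrow> nat \<Rightarrow> 'a \<Rightarrow> real" and u :: "nat \<Rightarrow> 'a \<Rightarrow> real"
  assumes dyn: "exchange_dynamics M N u g r"
    and u: "\<And>i. i \<in> {1..N} \<Longrightarrow> distributed M lborel (u i) (exponential_density 1)"
    and bound: "\<And>V. indep_vars (\<lambda>_. borel) V {1..N} \<Longrightarrow>
      \<forall>i\<in>{1..N}. distributed M lborel (V i) (exponential_density 1) \<Longrightarrow>
      prob {\<omega> \<in> space M. \<eta> < \<bar>cdf (empirical_measure N (normalized_wealth N (\<lambda>i. V i \<omega>))) z - c\<bar>} \<le> p"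
  obtains B where "B \<in> events" "prob B \<le> p"
    "{\<omega> \<in> space M. \<eta> < \<bar>cdf (empirical_measure N (wealth_at N (\<lambda>i j k. g i j k \<omega>) (\<lambda>i j k. r i j k \<omega>)
       (normalized_wealth N (\<lambda>i. u i \<omega>)) t)) z - c\<bar>} \<subseteq> B"
proof -
  define X where "X s = (case s of Initial i \<Rightarrow> u i | Gap i j k \<Rightarrow> g i j k | Split i j k \<Rightarrow> r i j k)" for s
  have indep: "indep_vars (\<lambda>_. borel) X (noise_sources N)"
    using dyn by (simp add: exchange_dynamics_def X_def[abs_def])
  define dev where "dev x \<longleftrightarrow> \<eta> < \<bar>cdf (empirical_measure N (normalized_wealth N x)) z - c\<bar>" for x
  have dev_cong: "dev x = dev y" if "\<And>i. i \<in> {1..N} \<Longrightarrow> x i = y i" for x y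
  proof -
    have "normalized_wealth N x i = normalized_wealth N y i" if "i \<in> {1..N}" for i
      using \<open>\<And>i. i \<in> {1..N} \<Longrightarrow> x i = y i\<close> that by (simp add: normalized_wealth_def)
    then show ?thesis
      by (simp add: dev_def cdf_empirical_measure)
  qed
  define L where "L = {l. set l \<subseteq> interactions N}"
  define E where "E l = {\<omega> \<in> space M. rings_in_order N (\<lambda>i j k. g i j k \<omega>) t l}" for l
  define D where "D l = {\<omega> \<in> space M. dev (replay l (\<lambda>s. X s \<omega>))}" for l
  have sub: "gap_sources N \<subseteq> noise_sources N" "replay_sources N \<subseteq> noise_sources N"
    "gap_sources N \<inter> replay_sources N = {}"
    by (auto simp: gap_sources_def replay_sources_def noise_sources_def interactions_def)
  have ind: "indep_var (PiM (gap_sources N) (\<lambda>_. borel)) (\<lambda>\<omega>. restrict (\<lambda>s. X s \<omega>) (gap_sources N))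
      (PiM (replay_sources N) (\<lambda>_. borel)) (\<lambda>\<omega>. restrict (\<lambda>s. X s \<omega>) (replay_sources N))"
    using sub by (intro indep_var_restrict[OF indep])
  have ED: "E l \<in> events \<and> D l \<in> events \<and> prob (E l \<inter> D l) = prob (E l) * prob (D l)" if "l \<in> L" for l
  proof -
    have l: "set l \<subseteq> interactions N" using that by (simp add: L_def)
    let ?f = "\<lambda>h. rings_in_order N (\<lambda>i j k. h (Gap i j k)) t l"
    let ?d = "\<lambda>h. dev (replay l h)"
    note [measurable] = measurable_replay[OF l]
    have d: "?d \<in> measurable (PiM (replay_sources N) (\<lambda>_. borel)) (count_space UNIV)"
      unfolding dev_def cdf_empirical_measure normalized_wealth_def by measurable
    have fr: "?f (restrict (\<lambda>s. X s \<omega>) (gap_sources N)) = rings_in_order N (\<lambda>i j k. g i j k \<omega>) t l" for \<omega>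
    proof (rule rings_in_order_cong[OF _ l])
      fix x assume x: "x \<in> interactions N"
      obtain i j k where ijk: "x = (i, j, k)" by (cases x)
      have "Gap i j m \<in> gap_sources N" for m
        using x by (force simp: ijk gap_sources_def interactions_def)
      then show "ring_time (\<lambda>i j k. restrict (\<lambda>s. X s \<omega>) (gap_sources N) (Gap i j k)) x
          = ring_time (\<lambda>i j k. g i j k \<omega>) x"
        by (simp add: ijk ring_time_def X_def)
    qed
    have dr: "?d (restrict (\<lambda>s. X s \<omega>) (replay_sources N)) = dev (replay l (\<lambda>s. X s \<omega>))" for \<omega>
      by (intro dev_cong replay_cong[OF l]) auto
    have "indep_var (count_space UNIV) (?f \<circ> (\<lambda>\<omega>. restrict (\<lambda>s. X s \<omega>) (gap_sources N)))
        (count_space UNIV) (?d \<circ> (\<lambda>\<omega>. restrict (\<lambda>s. X s \<omega>) (replay_sources N)))"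
      by (rule indep_var_compose[OF ind measurable_rings_in_order[OF l] d])
    then have iv: "indep_var (count_space UNIV) (\<lambda>\<omega>. rings_in_order N (\<lambda>i j k. g i j k \<omega>) t l)
        (count_space UNIV) (\<lambda>\<omega>. dev (replay l (\<lambda>s. X s \<omega>)))"
      by (simp only: comp_def fr dr)
    have "E l = (\<lambda>\<omega>. rings_in_order N (\<lambda>i j k. g i j k \<omega>) t l) -` {True} \<inter> space M"
      "D l = (\<lambda>\<omega>. dev (replay l (\<lambda>s. X s \<omega>))) -` {True} \<inter> space M"
      "E l \<inter> D l = (\<lambda>\<omega>. (rings_in_order N (\<lambda>i j k. g i j k \<omega>) t l, dev (replay l (\<lambda>s. X s \<omega>)))) -` ({True} \<times> {True}) \<inter> space M"
      by (auto simp: E_def D_def)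
    moreover have "(\<lambda>\<omega>. rings_in_order N (\<lambda>i j k. g i j k \<omega>) t l) -` {True} \<inter> space M \<in> events"
      "(\<lambda>\<omega>. dev (replay l (\<lambda>s. X s \<omega>))) -` {True} \<inter> space M \<in> events"
      using iv by (auto simp: indep_var_eq intro: measurable_sets)
    ultimately show ?thesis
      using indep_varD[OF iv, of "{True}" "{True}"] by simp
  qed
  then have [measurable]: "E l \<in> events" "D l \<in> events" if "l \<in> L" for l
    using that by auto
  have Dp: "prob (D l) \<le> p" if "l \<in> L" "distinct l" for l
  proof -
    have l: "set l \<subseteq> interactions N" using that by (simp add: L_def)
    have "indep_vars (\<lambda>_. borel) X (Initial ` {1..N} \<union> (\<lambda>(i, j, k). Split i j k) ` set l)"
      using l by (intro indep_vars_subset[OF indep]) (auto simp: noise_sources_def interactions_def)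
    moreover have "distributed M lborel (X (Initial n)) (exponential_density 1)" if "n \<in> {1..N}" for n
      using u[OF that] by (simp add: X_def)
    moreover have "distr M borel (X (Split i j k)) = uniform_measure lborel {0..1}" if "(i, j, k) \<in> set l" for i j k
      using dyn l that by (auto simp: exchange_dynamics_def X_def interactions_def)
    ultimately have "indep_vars (\<lambda>_. borel) (\<lambda>n \<omega>. replay l (\<lambda>s. X s \<omega>) n) {1..N} \<and>
      (\<forall>n\<in>{1..N}. distributed M lborel (\<lambda>\<omega>. replay l (\<lambda>s. X s \<omega>) n) (exponential_density 1))"
      using that(2) l by (intro replay_iid_exponential)
    then show ?thesis
      unfolding D_def dev_def by (intro bound) auto
  qed
  \<comment> \<open>The bound applies to the probability that belongs to the empty list, so \<open>p\<close> is not negative.\<close>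
  have p: "0 \<le> p"
    using order_trans[OF measure_nonneg[of M "D []"] Dp[of "[]"]] by (simp add: L_def)
  have E_unique: "sorted_key_list_of_set (ring_time (\<lambda>i j k. g i j k \<omega>)) (rings_until N (\<lambda>i j k. g i j k \<omega>) t) = l"
    "distinct l" "l \<in> L" if "\<omega> \<in> E l" for \<omega> l
    using rings_in_order_unique[of N "\<lambda>i j k. g i j k \<omega>" t l] that by (auto simp: E_def L_def)
  have disj: "disjoint_family_on E L"
    unfolding disjoint_family_on_def
  proof (intro ballI impI)
    fix l l' :: "(nat \<times> nat \<times> nat) list" assume "l \<noteq> l'"
    then have False if "\<omega> \<in> E l" "\<omega> \<in> E l'" for \<omega>
      using E_unique(1)[OF that(1)] E_unique(1)[OF that(2)] by simp
    then show "E l \<inter> E l' = {}"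
      by blast
  qed
  then have disj': "disjoint_family_on (\<lambda>l. E l \<inter> D l) L"
    unfolding disjoint_family_on_def by blast
  have le: "emeasure M (E l \<inter> D l) \<le> ennreal p * emeasure M (E l)" if "l \<in> L" for l
  proof (cases "distinct l")
    case True
    then have "prob (E l \<inter> D l) \<le> p * prob (E l)"
      using ED[OF that] Dp[OF that True] by (simp add: mult.commute mult_right_mono)
    then show ?thesis
      using p by (simp add: emeasure_eq_measure ennreal_leI flip: ennreal_mult)
  next
    case False
    then have "E l = {}"
      using E_unique(2) by auto
    then show ?thesis by simp
  qed
  have "emeasure M (\<Union>l\<in>L. E l \<inter> D l) = (\<integral>\<^sup>+l. emeasure M (E l \<inter> D l) \<partial>count_space L)"
    using disj' by (intro emeasure_UN_countable) auto
  also have "\<dots> \<le> (\<integral>\<^sup>+l. ennreal p * emeasure M (E l) \<partial>count_space L)"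
    using le by (intro nn_integral_mono) simp
  also have "\<dots> = ennreal p * (\<integral>\<^sup>+l. emeasure M (E l) \<partial>count_space L)"
    by (intro nn_integral_cmult) simp
  also have "(\<integral>\<^sup>+l. emeasure M (E l) \<partial>count_space L) = emeasure M (\<Union>l\<in>L. E l)"
    using disj by (intro emeasure_UN_countable[symmetric]) auto
  also have "ennreal p * \<dots> \<le> ennreal p * 1"
    by (intro mult_left_mono emeasure_le_1) simp
  finally have U: "emeasure M (\<Union>l\<in>L. E l \<inter> D l) \<le> ennreal p"
    by simp
  obtain N0 where N0: "N0 \<in> null_sets M"
    "{\<omega> \<in> space M. \<not> inj_on (ring_time (\<lambda>i j k. g i j k \<omega>)) (interactions N)} \<subseteq> N0"
    using AE_inj_on_ring_time[OF dyn] unfolding eventually_ae_filter by blast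
  have UM: "(\<Union>l\<in>L. E l \<inter> D l) \<in> events"
    by (intro sets.countable_UN'') auto
  show ?thesis
  proof (rule that)
    show "N0 \<union> (\<Union>l\<in>L. E l \<inter> D l) \<in> events"
      using N0(1) UM by auto
    have "emeasure M (N0 \<union> (\<Union>l\<in>L. E l \<inter> D l)) = emeasure M (\<Union>l\<in>L. E l \<inter> D l)"
      using emeasure_Un_null_set[OF UM N0(1)] by (simp add: Un_commute)
    with U show "prob (N0 \<union> (\<Union>l\<in>L. E l \<inter> D l)) \<le> p"
      using p by (simp add: emeasure_eq_measure)
    show "{\<omega> \<in> space M. \<eta> < \<bar>cdf (empirical_measure N (wealth_at N (\<lambda>i j k. g i j k \<omega>) (\<lambda>i j k. r i j k \<omega>)
       (normalized_wealth N (\<lambda>i. u i \<omega>)) t)) z - c\<bar>} \<subseteq> N0 \<union> (\<Union>l\<in>L. E l \<inter> D l)"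
    proof (rule subsetI)
      fix \<omega> assume \<omega>: "\<omega> \<in> {\<omega> \<in> space M. \<eta> < \<bar>cdf (empirical_measure N (wealth_at N (\<lambda>i j k. g i j k \<omega>)
        (\<lambda>i j k. r i j k \<omega>) (normalized_wealth N (\<lambda>i. u i \<omega>)) t)) z - c\<bar>}"
      show "\<omega> \<in> N0 \<union> (\<Union>l\<in>L. E l \<inter> D l)"
      proof (cases "\<omega> \<in> N0")
        case False
        then have "inj_on (ring_time (\<lambda>i j k. g i j k \<omega>)) (interactions N)"
          using \<omega> N0(2) by blast
        then obtain l where "rings_in_order N (\<lambda>i j k. g i j k \<omega>) t l"
          by (rule ex_rings_in_order)
        then have l: "\<omega> \<in> E l"
          using \<omega> by (simp add: E_def)
        have "wealth_at N (\<lambda>i j k. g i j k \<omega>) (\<lambda>i j k. r i j k \<omega>) (normalized_wealth N (\<lambda>i. u i \<omega>)) t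
            = normalized_wealth N (replay l (\<lambda>s. X s \<omega>))"
          using E_unique[OF l]
          by (simp add: wealth_at_def replay_def X_def L_def fold_exchange_normalized_wealth)
        then have "\<omega> \<in> D l"
          using \<omega> by (simp add: D_def dev_def)
        then show ?thesis
          using l E_unique(3)[OF l] by auto
      qed simp
    qed
  qed
qed

end


section \<open>Paths close in the Skorokhod distance\<close>

text \<open>The enlargement of a half-line \<open>{..y}\<close> is a half-line, so testing the Prohorov inequalities on
  half-lines compares distribution functions at shifted arguments. In this way
  laws are compared below through their distribution functions.\<close>

lemma prohorov_dist_less_imp_cdf_le:
  assumes less: "prohorov_dist P Q < d"
    and P: "real_distribution P" and Q: "real_distribution Q"
  shows "cdf P y \<le> cdf Q (y + d) + d" "cdf Q y \<le> cdf P (y + d) + d"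
proof -
  interpret P: real_distribution P by (rule P)
  interpret Q: real_distribution Q by (rule Q)
  define S where "S = {e::real. 0 < e \<and> (\<forall>A\<in>sets borel.
     measure P A \<le> measure Q (\<Union>a\<in>A. ball a e) + e \<and>
     measure Q A \<le> measure P (\<Union>a\<in>A. ball a e) + e)}"
  have "measure P A \<le> measure Q B + 1" "measure Q A \<le> measure P B + 1" for A B
    using P.prob_le_1[of A] Q.prob_le_1[of A] measure_nonneg[of P B] measure_nonneg[of Q B] by linarith+
  then have "1 \<in> S"
    by (simp add: S_def)
  moreover have "Inf S < d"
    using less by (simp add: S_def prohorov_dist_def)
  ultimately obtain e where e: "e \<in> S" "e < d"
    using cInf_lessD[of S d] by blast
  have sub: "(\<Union>a\<in>{..y}. ball a e) \<subseteq> {..y + d}"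
    using e(2) by (auto simp: dist_real_def)
  have "measure P {..y} \<le> measure Q (\<Union>a\<in>{..y}. ball a e) + e"
    using e(1) by (auto simp: S_def)
  also have "measure Q (\<Union>a\<in>{..y}. ball a e) \<le> measure Q {..y + d}"
    by (rule Q.finite_measure_mono[OF sub]) simp
  finally show "cdf P y \<le> cdf Q (y + d) + d"
    using e(2) by (simp add: cdf_def)
  have "measure Q {..y} \<le> measure P (\<Union>a\<in>{..y}. ball a e) + e"
    using e(1) by (auto simp: S_def)
  also have "measure P (\<Union>a\<in>{..y}. ball a e) \<le> measure P {..y + d}"
    by (rule P.finite_measure_mono[OF sub]) simp
  finally show "cdf Q y \<le> cdf P (y + d) + d"
    using e(2) by (simp add: cdf_def)
qed

lemma time_change_0:
  assumes "time_change l"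
  shows "l 0 = 0"
proof -
  have bij: "bij_betw l {0..} {0..}" and mono: "strict_mono_on {0..} l"
    using assms by (auto simp: time_change_def)
  obtain x where x: "x \<ge> 0" "l x = 0"
    using bij_betw_imp_surj_on[OF bij] by (metis atLeast_iff imageE order_refl)
  have "l 0 \<ge> 0"
    using bij_betw_apply[OF bij, of 0] by simp
  with x show ?thesis
    using strict_mono_onD[OF mono, of 0 x] by (cases "x = 0") auto
qed

text \<open>Applying the bound on the distortion to the pair of times \<open>0\<close> and \<open>t\<close> controls \<open>l t / t\<close>, because
  \<open>l 0 = 0\<close>.\<close>

lemma time_change_displacement:
  assumes l: "time_change l" and dist: "distortion l \<le> ennreal e" and e: "0 \<le> e" and t: "0 < t"
  shows "0 < l t" "l t \<le> exp e * t" "\<bar>l t - t\<bar> \<le> (exp e - 1) * t"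
proof -
  have mono: "strict_mono_on {0..} l"
    using l by (auto simp: time_change_def)
  show pos: "0 < l t"
    using strict_mono_onD[OF mono, of 0 t] t time_change_0[OF l] by simp
  have "ennreal \<bar>ln ((l t - l 0) / (t - 0))\<bar> \<le> distortion l"
    unfolding distortion_def using t
    by (intro SUP_upper2[of "(0, t)"]) auto
  also note dist
  finally have ln: "\<bar>ln (l t / t)\<bar> \<le> e"
    using e by (simp add: time_change_0[OF l])
  have "ln (l t / t) \<le> e" using ln by linarith
  then have "l t / t \<le> exp e"
    using pos t by (metis divide_pos_pos exp_le_cancel_iff exp_ln)
  then show up: "l t \<le> exp e * t"
    using t by (simp add: field_simps)
  have "- e \<le> ln (l t / t)" using ln by linarith
  then have "exp (- e) \<le> l t / t"
    using pos t by (metis divide_pos_pos exp_le_cancel_iff exp_ln)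
  then have lo: "exp (- e) * t \<le> l t"
    using t by (simp add: field_simps)
  have "1 - exp (- e) = exp (- e) * (exp e - 1)"
    by (simp add: right_diff_distrib flip: exp_add)
  also have "\<dots> \<le> 1 * (exp e - 1)"
    using e by (intro mult_right_mono) auto
  finally have "(1 - exp (- e)) * t \<le> (exp e - 1) * t"
    using t by (intro mult_right_mono) auto
  with lo up show "\<bar>l t - t\<bar> \<le> (exp e - 1) * t"
    by (simp add: algebra_simps)
qed

text \<open>Skorokhod closeness of two paths does not give closeness at equal times, but it does give closeness
  of \<open>x\<close> at a prescribed time \<open>t\<close> to \<open>y\<close> at some nearby time. The factor \<open>exp (2 * t + 1)\<close> undoes the
  weight \<open>exp (- u)\<close> on the window of times \<open>u\<close> that is retained from the integral.\<close>

lemma skorokhod_dist_less_imp_close: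
  assumes less: "skorokhod_dist \<rho> x y < ennreal e"
    and e: "exp e \<le> 2" "e * exp (2 * t + 1) \<le> \<eta>" "\<eta> \<le> 1" and t: "0 < t"
  obtains s where "0 < s" "\<bar>s - t\<bar> \<le> (exp e - 1) * t" "\<rho> (x t) (y s) < \<eta>"
proof -
  have epos: "0 < e"
    using less by (metis ennreal_neg linorder_not_le not_less_zero)
  obtain l where l: "time_change l" and dist: "distortion l < ennreal e"
    and int: "(\<integral>\<^sup>+u\<in>{0..}. ennreal (exp (- u)) *
          (SUP t\<in>{0..}. ennreal (min 1 (\<rho> (x (min t u)) (y (min (l t) u))))) \<partial>lborel) < ennreal e"
    using less unfolding skorokhod_dist_def INF_less_iff by auto
  note disp = time_change_displacement[OF l less_imp_le[OF dist] less_imp_le[OF epos] t]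
  define m where "m = ennreal (min 1 (\<rho> (x t) (y (l t))))"
  define q where "q = max 0 (min 1 (\<rho> (x t) (y (l t))))"
  have q_nonneg: "0 \<le> q" and m: "m = ennreal q"
    by (auto simp: q_def m_def)
  have lt: "l t \<le> 2 * t"
    using disp(2) e(1) t by (meson mult_right_mono order_trans less_imp_le)
  have "ennreal (exp (- (2 * t + 1))) * m
      = (\<integral>\<^sup>+u. ennreal (exp (- (2 * t + 1))) * m * indicator {2 * t..2 * t + 1} u \<partial>lborel)"
    by (simp add: nn_integral_cmult_indicator)
  \<comment> \<open>From time \<open>2 * t\<close> on, neither \<open>t\<close> nor \<open>l t\<close> is cut off any more.\<close>
  also have "\<dots> \<le> (\<integral>\<^sup>+u\<in>{0..}. ennreal (exp (- u)) *
          (SUP t\<in>{0..}. ennreal (min 1 (\<rho> (x (min t u)) (y (min (l t) u))))) \<partial>lborel)"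
  proof (intro nn_integral_mono)
    fix u :: real
    show "ennreal (exp (- (2 * t + 1))) * m * indicator {2 * t..2 * t + 1} u
      \<le> ennreal (exp (- u)) *
          (SUP t\<in>{0..}. ennreal (min 1 (\<rho> (x (min t u)) (y (min (l t) u))))) * indicator {0..} u"
    proof (cases "u \<in> {2 * t..2 * t + 1}")
      case True
      then have "min t u = t" "min (l t) u = l t"
        using t lt by auto
      then have "m \<le> (SUP t\<in>{0..}. ennreal (min 1 (\<rho> (x (min t u)) (y (min (l t) u)))))"
        unfolding m_def using t by (intro SUP_upper2[of t]) auto
      then show ?thesis
        using True t by (auto intro!: mult_mono)
    qed simp
  qed
  also note int
  finally have "ennreal (exp (- (2 * t + 1))) * m < ennreal e" .
  then have "exp (- (2 * t + 1)) * q < e"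
    by (simp add: m ennreal_less_iff q_nonneg flip: ennreal_mult')
  then have "exp (2 * t + 1) * (exp (- (2 * t + 1)) * q) < exp (2 * t + 1) * e"
    by (intro mult_strict_left_mono) auto
  also have "exp (2 * t + 1) * (exp (- (2 * t + 1)) * q) = q"
    by (simp only: mult.assoc[symmetric] exp_add[symmetric]) simp
  also have "exp (2 * t + 1) * e \<le> \<eta>"
    using e(2) by (simp add: mult.commute)
  finally have "\<rho> (x t) (y (l t)) < \<eta>"
    using e(3) by (auto simp: q_def)
  with disp show ?thesis
    using that by blast
qed


section \<open>Identification of the mean-field limit\<close>

lemma ex_small_distortion:
  fixes t d :: real
  assumes "0 < d"
  obtains e where "0 < e" "exp e \<le> 2" "e * exp (2 * t + 1) \<le> d" "(exp e - 1) * t \<le> d"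
proof -
  have lims: "((\<lambda>e. exp e) \<longlongrightarrow> exp 0) (at_right (0::real))"
    "((\<lambda>e. e * exp (2 * t + 1)) \<longlongrightarrow> 0 * exp (2 * t + 1)) (at_right (0::real))"
    "((\<lambda>e. (exp e - 1) * t) \<longlongrightarrow> (exp 0 - 1) * t) (at_right (0::real))"
    by (intro tendsto_intros)+
  have "\<forall>\<^sub>F e in at_right (0::real). exp e < 2"
    by (rule order_tendstoD(2)[OF lims(1)]) simp
  moreover have "\<forall>\<^sub>F e in at_right (0::real). e * exp (2 * t + 1) < d"
    by (rule order_tendstoD(2)[OF lims(2)]) (simp add: assms)
  moreover have "\<forall>\<^sub>F e in at_right (0::real). (exp e - 1) * t < d"
    by (rule order_tendstoD(2)[OF lims(3)]) (simp add: assms)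
  moreover have "\<forall>\<^sub>F e in at_right (0::real). 0 < e"
    by (rule eventually_at_right_less)
  ultimately have "\<forall>\<^sub>F e in at_right (0::real). 0 < e \<and> exp e \<le> 2 \<and> e * exp (2 * t + 1) \<le> d \<and> (exp e - 1) * t \<le> d"
    by eventually_elim auto
  then show ?thesis
    using that eventually_happens'[OF trivial_limit_at_right_real] by blast
qed

text \<open>Around any time \<open>t' > t\<close> there are times at which the path is close to \<open>Q\<close>. Let \<open>t'\<close> decrease to \<open>t\<close>,
  staying so close to \<open>t'\<close> that these times remain to the right of \<open>t\<close>: right-continuity carries the
  closeness over to \<open>t\<close> itself, whether or not \<open>t\<close> is a time of a jump.\<close>

lemma cadlag_path_eq_if_close_cdf:
  assumes \<mu>: "cadlag_path \<mu>" and Q: "real_distribution Q" and cont: "\<And>x. isCont (cdf Q) x"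
    and close: "\<And>t d y. 0 < t \<Longrightarrow> 0 < d \<Longrightarrow> \<exists>s>0. \<bar>s - t\<bar> \<le> d \<and>
      cdf (\<mu> s) y \<le> cdf Q (y + d) + 2 * d \<and> cdf Q (y - d) - 2 * d \<le> cdf (\<mu> s) y"
    and t: "0 \<le> t"
  shows "\<mu> t = Q"
proof -
  interpret Q: real_distribution Q by (rule Q)
  have rd: "real_distribution (\<mu> s)" if "0 \<le> s" for s
    using \<mu> that by (auto simp: cadlag_path_def half_line_distribution_def)
  have bounds: "cdf (\<mu> t) y \<le> cdf Q (y + 2 * d) + 3 * d \<and> cdf Q (y - 2 * d) - 3 * d \<le> cdf (\<mu> t) y"
    if d: "0 < d" for y d
  proof -
    have "((\<lambda>s. prohorov_dist (\<mu> s) (\<mu> t)) \<longlongrightarrow> 0) (at_right t)"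
      using \<mu> t by (auto simp: cadlag_path_def)
    then have "\<forall>\<^sub>F s in at_right t. prohorov_dist (\<mu> s) (\<mu> t) < d"
      using d by (auto dest: order_tendstoD(2))
    then obtain b where b: "t < b" "\<And>s. t < s \<Longrightarrow> s < b \<Longrightarrow> prohorov_dist (\<mu> s) (\<mu> t) < d"
      unfolding eventually_at_right_field by blast
    \<comment> \<open>With this tolerance, times that are close to the midpoint of \<open>t\<close> and \<open>b\<close> lie strictly between them.\<close>
    define d' where "d' = min d ((b - t) / 4)"
    have d': "0 < d'" "d' \<le> d" "d' \<le> (b - t) / 4"
      using d b(1) by (simp_all only: d'_def min.cobounded1 min.cobounded2 min_less_iff_conj) simp
    have t': "0 < (t + b) / 2"
      using t b(1) by simp
    have near: "t < s" "s < b" if "\<bar>s - (t + b) / 2\<bar> \<le> d'" for s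
      using conjunct1[OF that[unfolded abs_diff_le_iff]] conjunct2[OF that[unfolded abs_diff_le_iff]] d'(3) b(1)
      by (simp_all add: field_simps)
    obtain s where s: "0 < s" "\<bar>s - (t + b) / 2\<bar> \<le> d'" "cdf (\<mu> s) (y + d) \<le> cdf Q (y + d + d') + 2 * d'"
      using close[OF t' d'(1), of "y + d"] by blast
    obtain r where r: "0 < r" "\<bar>r - (t + b) / 2\<bar> \<le> d'" "cdf Q (y - d - d') - 2 * d' \<le> cdf (\<mu> r) (y - d)"
      using close[OF t' d'(1), of "y - d"] by blast
    have "cdf (\<mu> t) y \<le> cdf (\<mu> s) (y + d) + d"
      using near[OF s(2)] s(1) t by (intro prohorov_dist_less_imp_cdf_le(2)[OF b(2) rd rd]) auto
    moreover have "cdf Q (y + d + d') \<le> cdf Q (y + 2 * d)"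
      using d' by (intro Q.cdf_nondecreasing) simp
    moreover have "cdf (\<mu> r) (y - d) \<le> cdf (\<mu> t) (y - d + d) + d"
      using near[OF r(2)] r(1) t by (intro prohorov_dist_less_imp_cdf_le(1)[OF b(2) rd rd]) auto
    moreover have "cdf Q (y - 2 * d) \<le> cdf Q (y - d - d')"
      using d' by (intro Q.cdf_nondecreasing) simp
    ultimately show ?thesis
      using s(3) r(3) d'(2) by simp
  qed
  have "cdf (\<mu> t) y = cdf Q y" for y
  proof (rule antisym)
    have lim: "((\<lambda>d. y + 2 * d) \<longlongrightarrow> y) (at_right 0)" "((\<lambda>d. y - 2 * d) \<longlongrightarrow> y) (at_right 0)"
      by (auto intro!: tendsto_eq_intros)
    have "((\<lambda>d. cdf Q (y + 2 * d) + 3 * d) \<longlongrightarrow> cdf Q y + 3 * 0) (at_right 0)"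
      by (intro tendsto_intros isCont_tendsto_compose[OF cont lim(1)])
    then show "cdf (\<mu> t) y \<le> cdf Q y"
      using bounds by (intro tendsto_lowerbound[where F = "at_right (0::real)"])
        (auto intro!: eventually_mono[OF eventually_at_right_less])
    have "((\<lambda>d. cdf Q (y - 2 * d) - 3 * d) \<longlongrightarrow> cdf Q y - 3 * 0) (at_right 0)"
      by (intro tendsto_intros isCont_tendsto_compose[OF cont lim(2)])
    then show "cdf Q y \<le> cdf (\<mu> t) y"
      using bounds by (intro tendsto_upperbound[where F = "at_right (0::real)"])
        (auto intro!: eventually_mono[OF eventually_at_right_less])
  qed
  then show ?thesis
    by (intro cdf_unique rd t Q) (auto simp: fun_eq_iff)
qed

context prob_space begin

text \<open>The limit path is deterministic. So it suffices to find one outcome for which the empirical path is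
  close to the limit path in the Skorokhod distance and its distribution function at time \<open>t\<close> is close
  to that of \<open>Q\<close> at the two points \<open>y + d\<close> and \<open>y - d\<close>. For large \<open>N\<close> the three exceptional events have
  outer probabilities less than \<open>1 / 4\<close> each, so they do not exhaust the space.\<close>

lemma mean_field_limit_close_cdf:
  assumes lim: "mean_field_limit M X \<mu>"
    and dev: "\<And>t z d. 0 < t \<Longrightarrow> 0 < d \<Longrightarrow> \<exists>p. p \<longlonglongrightarrow> 0 \<and> (\<forall>N\<ge>2. \<exists>B\<in>events. prob B \<le> p N \<and>
      {\<omega> \<in> space M. d < \<bar>cdf (empirical_measure N (X N \<omega> t)) z - cdf Q z\<bar>} \<subseteq> B)"
    and t: "0 < t" and d: "0 < d"
  shows "\<exists>s>0. \<bar>s - t\<bar> \<le> d \<and>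
      cdf (\<mu> s) y \<le> cdf Q (y + d) + 2 * d \<and> cdf Q (y - d) - 2 * d \<le> cdf (\<mu> s) y"
proof -
  have rd: "real_distribution (\<mu> s)" if "0 \<le> s" for s
    using lim that by (auto simp: mean_field_limit_def cadlag_path_def half_line_distribution_def)
  have "0 < min d 1"
    using d by simp
  then obtain e where e: "0 < e" "exp e \<le> 2" "e * exp (2 * t + 1) \<le> min d 1" "(exp e - 1) * t \<le> min d 1"
    by (rule ex_small_distortion[of _ t])
  \<comment> \<open>Half of \<open>e\<close>, since outside this event the distance is only known not to exceed the threshold.\<close>
  define S where "S N = {\<omega> \<in> space M. skorokhod_dist prohorov_dist (\<lambda>t. empirical_measure N (X N \<omega> t)) \<mu> > ennreal (e / 2)}" for N
  define D where "D z N = {\<omega> \<in> space M. d < \<bar>cdf (empirical_measure N (X N \<omega> t)) z - cdf Q z\<bar>}" for z N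
  have "(\<lambda>N. outer_prob M (S N)) \<longlonglongrightarrow> 0"
    using conjunct2[OF lim[unfolded mean_field_limit_def], rule_format, of "e / 2"] e(1)
    unfolding S_def by simp
  then have S_small: "\<forall>\<^sub>F N in sequentially. outer_prob M (S N) < ennreal (1 / 4)"
    by (rule order_tendstoD(2)) simp
  obtain p1 where p1: "p1 \<longlonglongrightarrow> 0" "\<And>N. 2 \<le> N \<Longrightarrow> \<exists>B\<in>events. prob B \<le> p1 N \<and> D (y + d) N \<subseteq> B"
    using dev[OF t d, of "y + d"] unfolding D_def by blast
  obtain p2 where p2: "p2 \<longlonglongrightarrow> 0" "\<And>N. 2 \<le> N \<Longrightarrow> \<exists>B\<in>events. prob B \<le> p2 N \<and> D (y - d) N \<subseteq> B"
    using dev[OF t d, of "y - d"] unfolding D_def by blast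
  have "\<forall>\<^sub>F N in sequentially. p1 N < 1 / 4" "\<forall>\<^sub>F N in sequentially. p2 N < 1 / 4"
    by (rule order_tendstoD(2)[OF p1(1)], simp) (rule order_tendstoD(2)[OF p2(1)], simp)
  then have "\<forall>\<^sub>F N in sequentially. 2 \<le> N \<and> outer_prob M (S N) < ennreal (1 / 4) \<and> p1 N < 1 / 4 \<and> p2 N < 1 / 4"
    using S_small eventually_ge_at_top[of 2] by eventually_elim simp
  then obtain N where N: "2 \<le> N" "outer_prob M (S N) < ennreal (1 / 4)" "p1 N < 1 / 4" "p2 N < 1 / 4"
    using eventually_happens'[OF sequentially_bot] by blast
  obtain B0 where B0: "B0 \<in> events" "S N \<subseteq> B0" "prob B0 < 1 / 4"
    using N(2) by (auto simp: outer_prob_def INF_less_iff emeasure_eq_measure ennreal_less_iff)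
  obtain B1 where B1: "B1 \<in> events" "prob B1 < 1 / 4" "D (y + d) N \<subseteq> B1"
    using p1(2)[OF N(1)] N(3) by force
  obtain B2 where B2: "B2 \<in> events" "prob B2 < 1 / 4" "D (y - d) N \<subseteq> B2"
    using p2(2)[OF N(1)] N(4) by force
  have "prob (B0 \<union> B1 \<union> B2) \<le> prob (B0 \<union> B1) + prob B2"
    using B0 B1 B2 by (intro measure_Un_le) auto
  moreover have "prob (B0 \<union> B1) \<le> prob B0 + prob B1"
    using B0 B1 by (intro measure_Un_le) auto
  ultimately have "prob (B0 \<union> B1 \<union> B2) < 1"
    using B0 B1 B2 by simp
  then have "B0 \<union> B1 \<union> B2 \<noteq> space M"
    using prob_space by auto
  then obtain \<omega> where \<omega>: "\<omega> \<in> space M" "\<omega> \<notin> B0" "\<omega> \<notin> B1" "\<omega> \<notin> B2"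
    using sets.sets_into_space B0(1) B1(1) B2(1) by blast
  let ?P = "\<lambda>t. empirical_measure N (X N \<omega> t)"
  have "skorokhod_dist prohorov_dist ?P \<mu> \<le> ennreal (e / 2)"
    using \<omega> B0(2) by (auto simp: S_def not_less)
  also have "\<dots> < ennreal e"
    using e(1) by (simp add: ennreal_less_iff)
  finally have "skorokhod_dist prohorov_dist ?P \<mu> < ennreal e" .
  from skorokhod_dist_less_imp_close[OF this e(2,3) min.cobounded2 t]
  obtain s where s: "0 < s" "\<bar>s - t\<bar> \<le> (exp e - 1) * t" "prohorov_dist (?P t) (\<mu> s) < min d 1"
    by blast
  have P: "real_distribution (?P t)"
    using N(1) by (intro real_distribution_empirical_measure) simp
  have less: "prohorov_dist (?P t) (\<mu> s) < d"
    using s(3) by simp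
  have "cdf (\<mu> s) y \<le> cdf (?P t) (y + d) + d" "cdf (?P t) (y - d) \<le> cdf (\<mu> s) (y - d + d) + d"
    using s(1) by (intro prohorov_dist_less_imp_cdf_le[OF less P rd]; simp)+
  moreover have "\<bar>cdf (?P t) (y + d) - cdf Q (y + d)\<bar> \<le> d" "\<bar>cdf (?P t) (y - d) - cdf Q (y - d)\<bar> \<le> d"
    using \<omega> B1(3) B2(3) by (auto simp: D_def)
  ultimately have "cdf (\<mu> s) y \<le> cdf Q (y + d) + 2 * d" "cdf Q (y - d) - 2 * d \<le> cdf (\<mu> s) y"
    by (auto simp: abs_le_iff)
  moreover have "\<bar>s - t\<bar> \<le> d"
    using s(2) e(4) by simp
  ultimately show ?thesis
    using s(1) by blast
qed

end

theorem theorem6p7: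
  fixes M :: "'a measure" and U :: "nat \<Rightarrow> nat \<Rightarrow> 'a \<Rightarrow> real"
  assumes "prob_space M"
    and "prob_space.indep_vars M (\<lambda>_. borel) (\<lambda>(N, i). U N i) {(N, i). i \<in> {1..N}}"
    and "\<And>N i. i \<in> {1..N} \<Longrightarrow> distributed M lborel (U N i) (exponential_density 1)"
  shows "(AE \<omega> in M. weak_conv_m
            (\<lambda>N. empirical_measure N (normalized_wealth N (\<lambda>i. U N i \<omega>)))
            (density lborel (exponential_density 1))) \<and>
         (\<forall>(G :: nat \<Rightarrow> nat \<Rightarrow> nat \<Rightarrow> nat \<Rightarrow> 'a \<Rightarrow> real) (R :: nat \<Rightarrow> nat \<Rightarrow> nat \<Rightarrow> nat \<Rightarrow> 'a \<Rightarrow> real)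
            (\<mu> :: real \<Rightarrow> real measure).
            (\<forall>N\<ge>2. exchange_dynamics M N (U N) (G N) (R N)) \<longrightarrow>
            mean_field_limit M
              (\<lambda>N \<omega>. wealth_at N (\<lambda>i j k. G N i j k \<omega>) (\<lambda>i j k. R N i j k \<omega>)
                 (normalized_wealth N (\<lambda>i. U N i \<omega>)))
              \<mu> \<longrightarrow>
            \<mu> 0 = density lborel (exponential_density 1) \<and>
            (\<forall>t>0. \<mu> t = density lborel (exponential_density 1)))"
proof (intro conjI allI impI)
  interpret prob_space M by (rule assms(1))
  have row: "indep_vars (\<lambda>_. borel) (U N) {1..N}" for N
  proof -
    have "indep_vars (\<lambda>_. borel) (\<lambda>(N, i). U N i) (Pair N ` {1..N})"
      by (rule indep_vars_subset[OF assms(2)]) auto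
    then show ?thesis
      using indep_vars_reindex[of "\<lambda>_. borel" "\<lambda>(N, i). U N i" "Pair N" "{1..N}"]
      by (simp add: inj_on_def)
  qed
  have "AE \<omega> in M. \<forall>q\<in>\<rat>. (\<lambda>N. cdf (empirical_measure N (normalized_wealth N (\<lambda>i. U N i \<omega>))) q)
      \<longlonglongrightarrow> cdf std_exponential q"
    using AE_cdf_empirical_tendsto[OF row assms(3)]
    by (subst AE_ball_countable) (auto simp: countable_rat)
  then show "AE \<omega> in M. weak_conv_m
      (\<lambda>N. empirical_measure N (normalized_wealth N (\<lambda>i. U N i \<omega>))) std_exponential"
  proof eventually_elim
    case (elim \<omega>)
    show ?case
    proof (rule weak_conv_m_if_cdf_tendsto_on_rationals)
      show "\<forall>\<^sub>F N in sequentially. real_distribution (empirical_measure N (normalized_wealth N (\<lambda>i. U N i \<omega>)))"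
        by (rule eventually_mono[OF eventually_ge_at_top[of 1] real_distribution_empirical_measure])
    qed (use elim real_distribution_std_exponential in auto)
  qed
  fix G R :: "nat \<Rightarrow> nat \<Rightarrow> nat \<Rightarrow> nat \<Rightarrow> 'a \<Rightarrow> real" and \<mu> :: "real \<Rightarrow> real measure"
  assume dyn: "\<forall>N\<ge>2. exchange_dynamics M N (U N) (G N) (R N)"
    and lim: "mean_field_limit M
      (\<lambda>N \<omega>. wealth_at N (\<lambda>i j k. G N i j k \<omega>) (\<lambda>i j k. R N i j k \<omega>) (normalized_wealth N (\<lambda>i. U N i \<omega>))) \<mu>"
      (is "mean_field_limit M ?X \<mu>")
  have dev: "\<exists>p. p \<longlonglongrightarrow> 0 \<and> (\<forall>N\<ge>2. \<exists>B\<in>events. prob B \<le> p N \<and>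
      {\<omega> \<in> space M. d < \<bar>cdf (empirical_measure N (?X N \<omega> t)) z - cdf std_exponential z\<bar>} \<subseteq> B)"
    if "0 < t" and d: "0 < d" for t z d
  proof -
    obtain p where p: "summable p" "\<forall>N V. indep_vars (\<lambda>_. borel) V {1..N} \<longrightarrow>
      (\<forall>i\<in>{1..N}. distributed M lborel (V i) (exponential_density 1)) \<longrightarrow>
      prob {\<omega> \<in> space M. d < \<bar>cdf (empirical_measure N (normalized_wealth N (\<lambda>i. V i \<omega>))) z
        - cdf std_exponential z\<bar>} \<le> p N"
      using normalized_empirical_cdf_concentration[OF d, of z] by blast
    have "\<exists>B\<in>events. prob B \<le> p N \<and>
      {\<omega> \<in> space M. d < \<bar>cdf (empirical_measure N (?X N \<omega> t)) z - cdf std_exponential z\<bar>} \<subseteq> B" if "2 \<le> N" for N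
      by (rule exchange_dynamics_deviation[OF dyn[rule_format, OF that] assms(3) p(2)[rule_format]]) blast+
    then show ?thesis
      using summable_LIMSEQ_zero[OF p(1)] by blast
  qed
  have "cadlag_path \<mu>"
    using lim by (simp add: mean_field_limit_def)
  from cadlag_path_eq_if_close_cdf[OF this real_distribution_std_exponential isCont_cdf_std_exponential
      mean_field_limit_close_cdf[OF lim dev]]
  have eq: "\<mu> t = std_exponential" if "0 \<le> t" for t
    using that by blast
  show "\<mu> 0 = std_exponential"
    by (rule eq) simp
  show "\<mu> t = std_exponential" if "0 < t" for t
    using that by (intro eq) simp
qed

end
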